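(* Let $C=\mathfrak{c}(\mathbf{w}_1,\dots,\mathbf{w}_n)$ be a simplicial cone in $\mathbb{R}^n$ generated by linearly independent unit vectors $\mathbf{w}_1,\dots,\mathbf{w}_n\in\mathbb{R}^n$. Then there exist an integer $N\le(n-1)!$, full-dimensional cones $C_1,\dots,C_N\subseteq\mathbb{R}^n$ and signs $s_1,\dots,s_N\in\{\pm1\}$ such that $$[C]\equiv\sum_{m=1}^N s_m[C_m]\quad\text{modulo indicator functions of lower-dimensional cones},$$ each $C_m$ is of the form $\mathfrak{c}(\mathbf{v}_1,\dots,\mathbf{v}_n)$ with generators satisfying properties (a), (b), (c), (d'), (e) listed in the context, and $$\tilde\Omega_n(C)=\sum_{m=1}^N s_m\,\tilde\Omega_n(C_m).$$ The cones $C_m$ have positive-definite and tridiagonal associated matrices, so their normalized solid angle measures $\tilde\Omega_n(C_m)$ can be computed via the simplified power series $T_{\boldsymbol\beta}$ of $C_m$ given in the context (i.e. $T_{\boldsymbol\beta}$ converges absolutely to $\tilde\Omega_n(C_m)$).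
   Context: $\mathfrak{c}(\cdot)$ denotes the cone of nonnegative linear combinations of the given vectors, $\langle\cdot\rangle$ the linear span, $[C]$ the indicator function of $C$. The relation "$\equiv$ modulo indicator functions of lower-dimensional cones" means that the difference of the two sides is a finite linear combination of indicator functions of polyhedral cones in $\mathbb{R}^n$ of affine dimension less than $n$. Normalized solid angle measure: $\tilde\Omega_n(C)=\mathrm{vol}_{n-1}(C\cap S_{n-1})/\mathrm{vol}_{n-1}(S_{n-1})$, where $S_{n-1}$ is the unit sphere in $\mathbb{R}^n$ centered at the origin; equivalently $\pi^{-n/2}\int_Ce^{-\|\mathbf{x}\|^2}d\mathbf{x}$. Properties of the generators $\mathbf{v}_1,\dots,\mathbf{v}_n$, where $M_n$ is the associated matrix of $\mathfrak{c}(\mathbf{v}_1,\dots,\mathbf{v}_n)$, with $(i,j)$ entry $-|\mathbf{v}_i\cdot\mathbf{v}_j|$ for $i\ne j$ and diagonal entries $1$: (a) $\|\mathbf{v}_i\|=1$ for all $i$; (b) $\mathbf{v}_n=\mathbf{w}_n$; (c) $\langle\mathbf{v}_1,\dots,\mathbf{v}_{n-1}\rangle=\langle\mathbf{w}_1,\dots,\mathbf{w}_{n-1}\rangle$; (d') $\mathbf{v}_i\cdot\mathbf{v}_j=0$ for all $1\le i,j\le n$ with $|i-j|\ge2$; (e) there are signs $\epsilon_i\in\{\pm1\}$ with $\mathbf{x}^TM_n\mathbf{x}=\|\sum_i\epsilon_ix_i\mathbf{v}_i\|^2$ for every $\mathbf{x}\in\mathbb{R}^n$. Simplified power series of such a cone: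 with $V$ the matrix whose columns are the $\mathbf{v}_i$, $\beta_i=\mathbf{v}_i\cdot\mathbf{v}_{i+1}$, and $b_0=b_n=0$, $$T_{\boldsymbol\beta}=\frac{|\det V|}{(4\pi)^{n/2}}\sum_{\mathbf{b}\in\mathbb{N}^{n-1}}\left[\frac{(-2)^{\sum_{i=1}^{n-1} b_i}}{\prod_{i=1}^{n-1}b_i!}\prod_{i=1}^n\Gamma\!\left(\frac{1+b_{i-1}+b_i}{2}\right)\right]\beta_1^{b_1}\cdots\beta_{n-1}^{b_{n-1}},$$ where $\mathbb{N}$ includes $0$ and $0^0=1$. *)

theory Defs
  imports "HOL-Analysis.Analysis" "HOL-Probability.Distributions"
begin

text \<open>
  Throughout, \<open>n = CARD('n)\<close> is the dimension of the ambient space, and a list of \<open>n\<close> vectors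
  \<open>v\<^sub>1, \<dots>, v\<^sub>n\<close> is a function \<open>v :: nat \<Rightarrow> real^'n\<close> of which only the values on \<open>{1..n}\<close>
  matter.
\<close>

subsection \<open>Cones and indicator functions\<close>

definition gen_cone :: "(nat \<Rightarrow> real^'n) \<Rightarrow> (real^'n) set" where
  "gen_cone v = {(\<Sum>i=1..CARD('n). c i *\<^sub>R v i) | c. \<forall>i\<in>{1..CARD('n)}. 0 \<le> c i}"

text \<open>Polyhedral cones have their apex at the origin: they are the finite intersections of closed
  half-spaces that are closed under nonnegative linear combinations.\<close>

definition equiv_mod_lower_dim :: "(real^'n \<Rightarrow> real) \<Rightarrow> (real^'n \<Rightarrow> real) \<Rightarrow> bool" where
  "equiv_mod_lower_dim f g \<longleftrightarrow>
     (\<exists>F a. finite F \<and>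
        (\<forall>K\<in>F. polyhedron K \<and> convex_cone K \<and> aff_dim K < int CARD('n)) \<and>
        (\<forall>x. f x - g x = (\<Sum>K\<in>F. a K * indicat_real K x)))"

subsection \<open>Normalized solid angle\<close>

text \<open>
  The \<open>(n-1)\<close>-dimensional volume of a subset \<open>A\<close> of the unit sphere, normalized as usual so that
  the volume element in polar coordinates is \<open>r\<^sup>n\<^sup>-\<^sup>1 dr d\<sigma>\<close>: it is \<open>n\<close> times the Lebesgue measure of
  the part of the unit ball lying over \<open>A\<close>. For \<open>n = 1\<close> this is the counting measure on \<open>{-1, 1}\<close>.
\<close>

definition sphere_vol :: "(real^'n) set \<Rightarrow> real" where
  "sphere_vol A =
     real CARD('n) * measure lebesgue {t *\<^sub>R x | t x. 0 < t \<and> t \<le> 1 \<and> x \<in> A}"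

definition solid_angle :: "(real^'n) set \<Rightarrow> real" where
  "solid_angle C = sphere_vol (C \<inter> sphere 0 1) / sphere_vol (sphere 0 1 :: (real^'n) set)"

subsection \<open>Matrices\<close>

text \<open>
  The entries of a matrix \<open>real^'n^'n\<close> are indexed by the type \<open>'n\<close>; \<open>pos\<close> identifies this index
  type with \<open>{1..n}\<close>. The particular bijection is irrelevant: another choice permutes the
  coordinates.
\<close>

definition pos :: "'n::finite \<Rightarrow> nat" where
  "pos = (SOME f. bij_betw f UNIV {1..CARD('n)})"

lemma bij_betw_pos: "bij_betw (pos :: 'n::finite \<Rightarrow> nat) UNIV {1..CARD('n)}"
proof -
  have "\<exists>f. bij_betw f (UNIV :: 'n set) {1..CARD('n)}"
    by (rule finite_same_card_bij) auto
  thus ?thesis unfolding pos_def by (rule someI_ex)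
qed

definition gen_matrix :: "(nat \<Rightarrow> real^'n) \<Rightarrow> real^'n^'n" where
  "gen_matrix v = (\<chi> i j. v (pos j) $ i)"

definition assoc_matrix :: "(nat \<Rightarrow> real^'n) \<Rightarrow> real^'n^'n" where
  "assoc_matrix v = (\<chi> i j. if i = j then 1 else - \<bar>v (pos i) \<bullet> v (pos j)\<bar>)"

definition positive_definite :: "real^'n^'n \<Rightarrow> bool" where
  "positive_definite A \<longleftrightarrow> transpose A = A \<and> (\<forall>x. x \<noteq> 0 \<longrightarrow> 0 < x \<bullet> (A *v x))"

definition tridiagonal :: "real^'n^'n \<Rightarrow> bool" where
  "tridiagonal A \<longleftrightarrow> (\<forall>i j. 2 \<le> \<bar>int (pos i) - int (pos j)\<bar> \<longrightarrow> A $ i $ j = 0)"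

subsection \<open>Properties of the generators\<close>

text \<open>The last conjunct says that, up to the choice of signs, \<open>assoc_matrix v\<close> is the Gram matrix of the
  vectors \<open>\<plusminus>v\<^sub>1, \<dots>, \<plusminus>v\<^sub>n\<close>.\<close>

definition special_generators :: "(nat \<Rightarrow> real^'n) \<Rightarrow> (nat \<Rightarrow> real^'n) \<Rightarrow> bool" where
  "special_generators w v \<longleftrightarrow>
     (\<forall>i\<in>{1..CARD('n)}. norm (v i) = 1) \<and>
     v CARD('n) = w CARD('n) \<and>
     span (v ` {1..<CARD('n)}) = span (w ` {1..<CARD('n)}) \<and>
     (\<forall>i\<in>{1..CARD('n)}. \<forall>j\<in>{1..CARD('n)}. 2 \<le> \<bar>int i - int j\<bar> \<longrightarrow> v i \<bullet> v j = 0) \<and>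
     (\<exists>\<epsilon> :: 'n \<Rightarrow> real. (\<forall>i. \<epsilon> i \<in> {-1, 1}) \<and>
        (\<forall>x. x \<bullet> (assoc_matrix v *v x) = (norm (\<Sum>i\<in>UNIV. (\<epsilon> i * x $ i) *\<^sub>R v (pos i)))\<^sup>2))"

subsection \<open>The simplified power series\<close>

text \<open>Multi-exponents \<open>(b\<^sub>1, \<dots>, b\<^sub>n\<^sub>-\<^sub>1)\<close>, extended by \<open>0\<close>, which in particular encodes the convention
  \<open>b\<^sub>0 = b\<^sub>n = 0\<close>.\<close>

definition multi_exponents :: "nat \<Rightarrow> (nat \<Rightarrow> nat) set" where
  "multi_exponents n = {b. \<forall>i. i \<notin> {1..<n} \<longrightarrow> b i = 0}"

definition simplified_term :: "(nat \<Rightarrow> real^'n) \<Rightarrow> (nat \<Rightarrow> nat) \<Rightarrow> real" where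
  "simplified_term v b =
     (-2) ^ (\<Sum>i\<in>{1..<CARD('n)}. b i) / (\<Prod>i\<in>{1..<CARD('n)}. fact (b i))
     * (\<Prod>i\<in>{1..CARD('n)}. Gamma ((1 + real (b (i - 1)) + real (b i)) / 2))
     * (\<Prod>i\<in>{1..<CARD('n)}. (v i \<bullet> v (i + 1)) ^ b i)"

definition simplified_series :: "(nat \<Rightarrow> real^'n) \<Rightarrow> real" where
  "simplified_series v =
     \<bar>det (gen_matrix v)\<bar> / (4 * pi) powr (real CARD('n) / 2)
     * (\<Sum>\<^sub>\<infinity>b\<in>multi_exponents CARD('n). simplified_term v b)"

subsection \<open>The Gaussian formula for the solid angle\<close>

lemma sphere_vol_conic:
  fixes C :: "(real^'n) set"
  assumes "conic C" and "C \<in> sets lebesgue"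
  shows "sphere_vol (C \<inter> sphere 0 1) = real CARD('n) * measure lebesgue (C \<inter> cball 0 1)"
proof -
  have eq: "{t *\<^sub>R x | t x. 0 < t \<and> t \<le> 1 \<and> x \<in> C \<inter> sphere 0 1} = C \<inter> cball 0 1 - {0}" (is "?L = ?R")
  proof (intro equalityI subsetI)
    fix y assume "y \<in> ?L"
    thus "y \<in> ?R" using assms by (auto simp: conic_def)
  next
    fix y assume y: "y \<in> ?R"
    have "y = norm y *\<^sub>R ((1 / norm y) *\<^sub>R y)" "(1 / norm y) *\<^sub>R y \<in> C \<inter> sphere 0 1"
      using y assms by (auto simp: conic_def)
    moreover have "0 < norm y" "norm y \<le> 1" using y by auto
    ultimately show "y \<in> ?L" by blast
  qed
  have "C \<inter> cball 0 1 \<in> lmeasurable"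
    using assms(2) by (intro bounded_set_imp_lmeasurable) (auto intro: bounded_subset[of "cball 0 1"])
  hence "measure lebesgue (C \<inter> cball 0 1 - {0}) = measure lebesgue (C \<inter> cball 0 1)"
    by (rule measure_negligible_symdiff) 
      (use assms in \<open>auto intro: negligible_subset[of "{0}"] bounded_set_imp_lmeasurable\<close>)
  thus ?thesis unfolding sphere_vol_def eq by simp
qed

lemma nn_integral_gaussian_conic:
  fixes C :: "(real^'n) set"
  assumes C: "conic C" and [measurable]: "C \<in> sets borel"
  shows "(\<integral>\<^sup>+x. ennreal (exp (- (norm x)\<^sup>2)) * indicator C x \<partial>lborel) =
    (\<integral>\<^sup>+t. ennreal (2 * t * exp (- t\<^sup>2)) * indicator {0..} t * ennreal (t ^ CARD('n)) \<partial>lborel)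
      * emeasure lborel (C \<inter> cball 0 1)"
proof -
  have tail: "(\<integral>\<^sup>+t. ennreal (2 * t * exp (- t\<^sup>2)) * indicator {r..} t \<partial>lborel) = ennreal (exp (- r\<^sup>2))"
    if "0 \<le> r" for r :: real
  proof -
    have "((\<lambda>t::real. - exp (- t\<^sup>2)) \<longlongrightarrow> - 0) at_top"
      by (intro tendsto_intros filterlim_compose[OF exp_at_bot]
            filterlim_compose[OF filterlim_uminus_at_bot_at_top] filterlim_pow_at_top filterlim_ident) auto
    hence "(\<integral>\<^sup>+t. ennreal (2 * t * exp (- t\<^sup>2)) * indicator {r..} t \<partial>lborel) = ennreal (0 - (- exp (- r\<^sup>2)))"
      using that by (intro nn_integral_FTC_atLeast) (auto intro!: derivative_eq_intros)
    thus ?thesis by simp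
  qed
  have scale: "emeasure lborel (C \<inter> cball 0 t) = ennreal (t ^ CARD('n)) * emeasure lborel (C \<inter> cball 0 1)"
    if "0 < t" for t :: real
  proof -
    have "C \<inter> cball 0 t = (\<lambda>x. t *\<^sub>R x + 0) ` (C \<inter> cball 0 1)" (is "?L = ?R")
    proof (intro equalityI subsetI)
      fix y assume "y \<in> ?L"
      hence "(1 / t) *\<^sub>R y \<in> C \<inter> cball 0 1" "y = t *\<^sub>R ((1 / t) *\<^sub>R y) + 0"
        using that C by (auto simp: conic_def field_simps)
      thus "y \<in> ?R" by blast
    qed (use that C in \<open>auto simp: conic_def abs_mult mult_le_cancel_left1\<close>)
    hence "emeasure lebesgue (C \<inter> cball 0 t) = ennreal (\<bar>t\<bar> ^ CARD('n)) * emeasure lebesgue (C \<inter> cball 0 1)"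
      using emeasure_lebesgue_affine[of t "0 :: real^'n" "C \<inter> cball 0 1"] that
      by (simp add: ennreal_power)
    thus ?thesis using that by simp
  qed
  have "(\<integral>\<^sup>+x. ennreal (exp (- (norm x)\<^sup>2)) * indicator C x \<partial>lborel) =
        (\<integral>\<^sup>+x. (\<integral>\<^sup>+t. ennreal (2 * t * exp (- t\<^sup>2)) * indicator {0..} t * indicator {t. norm x \<le> t} t * indicator C x \<partial>lborel) \<partial>lborel)"
  proof (rule nn_integral_cong)
    fix x :: "real^'n"
    have "ennreal (exp (- (norm x)\<^sup>2)) * indicator C x =
      (\<integral>\<^sup>+t. ennreal (2 * t * exp (- t\<^sup>2)) * indicator {norm x..} t * indicator C x \<partial>lborel)"
      using tail[of "norm x"] by (simp add: nn_integral_multc)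
    also have "\<dots> = (\<integral>\<^sup>+t. ennreal (2 * t * exp (- t\<^sup>2)) * indicator {0..} t * indicator {t. norm x \<le> t} t * indicator C x \<partial>lborel)"
      by (rule nn_integral_cong) (auto simp: indicator_def intro: order_trans[OF norm_ge_zero])
    finally show "ennreal (exp (- (norm x)\<^sup>2)) * indicator C x = \<dots>" .
  qed
  also have "\<dots> = (\<integral>\<^sup>+t. (\<integral>\<^sup>+x. ennreal (2 * t * exp (- t\<^sup>2)) * indicator {0..} t * indicator {t. norm x \<le> t} t * indicator C x \<partial>lborel) \<partial>lborel)"
    by (rule lborel_pair.Fubini') (simp add: indicator_def, measurable)
  also have "\<dots> = (\<integral>\<^sup>+t. ennreal (2 * t * exp (- t\<^sup>2)) * indicator {0..} t * emeasure lborel (C \<inter> cball 0 t) \<partial>lborel)"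
  proof (rule nn_integral_cong)
    fix t :: real
    have "(\<integral>\<^sup>+x. ennreal (2 * t * exp (- t\<^sup>2)) * indicator {0..} t * indicator {t. norm x \<le> t} t * indicator C x \<partial>lborel)
      = (\<integral>\<^sup>+x. ennreal (2 * t * exp (- t\<^sup>2)) * indicator {0..} t * indicator (C \<inter> cball 0 t) x \<partial>lborel)"
      by (rule nn_integral_cong) (auto simp: indicator_def)
    also have "\<dots> = ennreal (2 * t * exp (- t\<^sup>2)) * indicator {0..} t * emeasure lborel (C \<inter> cball 0 t)"
      by (rule nn_integral_cmult_indicator) simp
    finally show "(\<integral>\<^sup>+x. ennreal (2 * t * exp (- t\<^sup>2)) * indicator {0..} t * indicator {t. norm x \<le> t} t * indicator C x \<partial>lborel) = \<dots>" .
  qed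
  also have "\<dots> = (\<integral>\<^sup>+t. ennreal (2 * t * exp (- t\<^sup>2)) * indicator {0..} t * ennreal (t ^ CARD('n)) * emeasure lborel (C \<inter> cball 0 1) \<partial>lborel)"
  proof (rule nn_integral_cong)
    fix t :: real
    show "ennreal (2 * t * exp (- t\<^sup>2)) * indicator {0..} t * emeasure lborel (C \<inter> cball 0 t) =
      ennreal (2 * t * exp (- t\<^sup>2)) * indicator {0..} t * ennreal (t ^ CARD('n)) * emeasure lborel (C \<inter> cball 0 1)"
      using scale[of t] by (cases t "0::real" rule: linorder_cases) (auto simp: mult.assoc)
  qed
  finally show ?thesis by (simp add: nn_integral_multc)
qed

lemma nn_integral_gaussian:
  "(\<integral>\<^sup>+x. ennreal (exp (- (norm x)\<^sup>2)) \<partial>(lborel :: (real^'n) measure)) =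
     ennreal (pi powr (real CARD('n) / 2))"
proof -
  have one: "(\<integral>\<^sup>+t. ennreal (exp (- t\<^sup>2)) \<partial>(lborel :: real measure)) = ennreal (sqrt pi)"
  proof -
    have "has_bochner_integral lborel (\<lambda>x::real. exp (- x\<^sup>2)) (2 *\<^sub>R (sqrt pi / 2))"
      by (rule has_bochner_integral_even_function[OF gaussian_moment_0]) simp
    thus ?thesis
      by (simp add: has_bochner_integral_iff nn_integral_eq_integral)
  qed
  have "(\<integral>\<^sup>+x. ennreal (exp (- (norm x)\<^sup>2)) \<partial>(lborel :: (real^'n) measure)) =
        (\<integral>\<^sup>+x. (\<Prod>b\<in>Basis. ennreal (exp (- (x \<bullet> b)\<^sup>2))) \<partial>(lborel :: (real^'n) measure))"
  proof (rule nn_integral_cong)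
    fix x :: "real^'n"
    have "(norm x)\<^sup>2 = (\<Sum>b\<in>Basis. (x \<bullet> b)\<^sup>2)"
      by (subst power2_norm_eq_inner, subst euclidean_inner) (simp add: power2_eq_square)
    thus "ennreal (exp (- (norm x)\<^sup>2)) = (\<Prod>b\<in>Basis. ennreal (exp (- (x \<bullet> b)\<^sup>2)))"
      by (simp add: prod_ennreal exp_sum[symmetric] sum_negf)
  qed
  also have "\<dots> = (\<Prod>b\<in>(Basis :: (real^'n) set). \<integral>\<^sup>+t. ennreal (exp (- t\<^sup>2)) \<partial>lborel)"
    by (rule nn_integral_lborel_prod) auto
  also have "\<dots> = ennreal (sqrt pi ^ CARD('n))"
    by (simp add: one ennreal_power)
  also have "sqrt pi ^ CARD('n) = pi powr (real CARD('n) / 2)"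
    by (simp add: powr_half_sqrt[symmetric] powr_powr powr_realpow[symmetric])
  finally show ?thesis .
qed

theorem solid_angle_gaussian:
  fixes C :: "(real^'n) set"
  assumes C: "conic C" "C \<in> sets borel"
  shows "solid_angle C =
    (\<integral>x\<in>C. exp (- (norm x)\<^sup>2) \<partial>lborel) / pi powr (real CARD('n) / 2)"
proof -
  define K where "K = (\<integral>\<^sup>+t. ennreal (2 * t * exp (- t\<^sup>2)) * indicator {0..} t * ennreal (t ^ CARD('n)) \<partial>lborel)"
  let ?B = "cball 0 1 :: (real^'n) set"
  have B: "0 < measure lborel ?B"
    using content_cball_pos[of 1 "0 :: real^'n"] by simp
  have int: "(\<integral>x\<in>C. exp (- (norm x)\<^sup>2) \<partial>lborel) = enn2real K * measure lborel (C \<inter> ?B)"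
  proof -
    have "(\<integral>x\<in>C. exp (- (norm x)\<^sup>2) \<partial>lborel) =
        enn2real (\<integral>\<^sup>+x. ennreal (exp (- (norm x)\<^sup>2)) * indicator C x \<partial>lborel)"
      unfolding set_lebesgue_integral_def using C
      by (subst integral_eq_nn_integral)
        (auto simp: indicator_def intro!: arg_cong[of _ _ enn2real] nn_integral_cong)
    thus ?thesis
      unfolding nn_integral_gaussian_conic[OF C] K_def[symmetric] measure_def
      by (simp add: enn2real_mult)
  qed
  have "ennreal (pi powr (real CARD('n) / 2)) = K * emeasure lborel ?B"
    using nn_integral_gaussian_conic[of "UNIV :: (real^'n) set"] nn_integral_gaussian[where 'n = 'n]
    by (simp add: K_def conic_def)
  hence total: "pi powr (real CARD('n) / 2) = enn2real K * measure lborel ?B"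
    unfolding measure_def enn2real_mult[symmetric] by (metis enn2real_ennreal powr_ge_zero)
  have "enn2real K \<noteq> 0" using total by auto
  moreover have "measure lebesgue (C \<inter> ?B) = measure lborel (C \<inter> ?B)"
    using C by (intro measure_completion) auto
  ultimately show ?thesis
    using sphere_vol_conic[of C] C sphere_vol_conic[of "UNIV :: (real^'n) set"] B
    by (simp add: solid_angle_def int total conic_def)
qed

end

theory Submission
  imports Defs
begin

text \<open>
  Let \<open>t\<close> be the last generator and \<open>\<phi> = (\<lambda>x. x \<bullet> t)\<close>. Inside the span of the other generators
  \<open>w\<^sub>j\<close>, the cone they generate is, off finitely many hyperplanes, a signed sum of cones indexed by
  those \<open>i\<close> with \<open>\<phi> w\<^sub>i \<noteq> 0\<close>; the \<open>i\<close>-th one is generated by \<open>w\<^sub>i\<close> and by vectors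
  \<open>\<plusminus>(w\<^sub>j - (\<phi> w\<^sub>j / \<phi> w\<^sub>i) w\<^sub>i)\<close>, which are orthogonal to \<open>t\<close>. Recursing with \<open>w\<^sub>i\<close> as the new last
  generator keeps everything below \<open>w\<^sub>i\<close> orthogonal to \<open>t\<close>, so the resulting Gram matrices are
  tridiagonal, and the number of cones multiplies up to at most \<open>(n - 1)!\<close>.

  An identity between indicator functions of polyhedral cones that holds off finitely many proper
  subspaces holds modulo lower-dimensional cones, because the difference can be multiplied by the
  indicator functions of these subspaces.

  For a tridiagonal cone the Gaussian integral over the orthant is expanded in the mixed terms
  \<open>exp (-2 \<beta>\<^sub>i y\<^sub>i y\<^sub>i\<^sub>+\<^sub>1)\<close>. The series of absolute values belongs to the form with coefficients
  \<open>- \<bar>\<beta>\<^sub>i\<bar>\<close>; since a tridiagonal Gram matrix is a path, suitable signs turn this into the Gram form of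
  \<open>\<plusminus>v\<^sub>1, \<dots>, \<plusminus>v\<^sub>n\<close>, whose Gaussian integral is finite.
\<close>

text \<open>From here the infix means integrability with respect to \<open>count_space\<close>, so
  that Fubini for Bochner integrals applies to sums. The conversion to \<open>summable_on\<close>
  happens in \<open>summable_simplified_term\<close>.\<close>

no_notation Infinite_Sum.abs_summable_on (infixr "abs'_summable'_on" 46)

subsection \<open>Signed decomposition of simplicial cones\<close>

text \<open>Independence is indexed rather than attached to a set of vectors, so that coefficients
  are functions of the index and repetitions count as dependence.\<close>

definition indep_family :: "'i set \<Rightarrow> ('i \<Rightarrow> 'a::real_vector) \<Rightarrow> bool" where
  "indep_family I w \<longleftrightarrow> (\<forall>c. (\<Sum>i\<in>I. c i *\<^sub>R w i) = 0 \<longrightarrow> (\<forall>i\<in>I. c i = 0))"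

text \<open>Properties (a) and (d') with a variable length \<open>n\<close>, so that a chain can be
  built one vector at a time. Inner products of neighbours stay unconstrained.\<close>

definition chain_family :: "nat \<Rightarrow> (nat \<Rightarrow> 'a::real_inner) \<Rightarrow> bool" where
  "chain_family n v \<longleftrightarrow> (\<forall>i\<in>{1..n}. norm (v i) = 1) \<and>
     (\<forall>i\<in>{1..n}. \<forall>j\<in>{1..n}. 2 \<le> \<bar>int i - int j\<bar> \<longrightarrow> v i \<bullet> v j = 0)"

section \<open>Spans and independence of indexed families\<close>

lemma span_image_sums:
  assumes "finite J"
  shows "span (w ` J) = {\<Sum>j\<in>J. c j *\<^sub>R w j | c. True}" (is "_ = ?R")
proof
  have "subspace ?R"
    unfolding subspace_def
  proof (intro conjI ballI allI)
    show "0 \<in> ?R"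
      by (intro CollectI exI[of _ "\<lambda>_. 0"]) auto
    show "x + y \<in> ?R" if "x \<in> ?R" "y \<in> ?R" for x y
    proof -
      obtain c d where "x = (\<Sum>j\<in>J. c j *\<^sub>R w j)" "y = (\<Sum>j\<in>J. d j *\<^sub>R w j)"
        using \<open>x \<in> ?R\<close> \<open>y \<in> ?R\<close> by blast
      then have "x + y = (\<Sum>j\<in>J. (c j + d j) *\<^sub>R w j)"
        by (simp add: scaleR_add_left sum.distrib)
      then show ?thesis by (auto intro!: exI[of _ "\<lambda>j. c j + d j"])
    qed
    show "r *\<^sub>R x \<in> ?R" if x: "x \<in> ?R" for r x
    proof -
      obtain c where "x = (\<Sum>j\<in>J. c j *\<^sub>R w j)"
        using x by blast
      then have "r *\<^sub>R x = (\<Sum>j\<in>J. (r * c j) *\<^sub>R w j)"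
        by (simp add: scaleR_sum_right)
      then show ?thesis by (auto intro!: exI[of _ "\<lambda>j. r * c j"])
    qed
  qed
  moreover have "w ` J \<subseteq> ?R"
  proof
    fix x assume "x \<in> w ` J"
    then obtain k where k: "k \<in> J" "x = w k" by blast
    have "x = (\<Sum>j\<in>J. (if j = k then 1 else 0) *\<^sub>R w j)"
      using k assms by (simp add: if_distrib[of "\<lambda>c. c *\<^sub>R _"] cong: if_cong)
    then show "x \<in> ?R"
      by (intro CollectI exI[of _ "\<lambda>j. if j = k then 1 else 0"]) simp
  qed
  ultimately show "span (w ` J) \<subseteq> ?R"
    by (rule span_minimal[rotated])
  show "?R \<subseteq> span (w ` J)"
    by clarify (intro span_sum span_scale span_base imageI)
qed

lemma indep_familyD:
  assumes "indep_family I w" "(\<Sum>i\<in>I. c i *\<^sub>R w i) = 0" "i \<in> I"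
  shows "c i = 0"
  using assms unfolding indep_family_def by blast

lemma indep_family_insert_iff:
  assumes "finite J" "t \<notin> J"
  shows "indep_family (insert t J) w \<longleftrightarrow> indep_family J w \<and> w t \<notin> span (w ` J)"
proof (intro iffI conjI)
  assume ind: "indep_family (insert t J) w"
  show "indep_family J w"
    unfolding indep_family_def
  proof (intro allI impI ballI)
    fix c i assume c: "(\<Sum>i\<in>J. c i *\<^sub>R w i) = 0" "i \<in> J"
    have "(\<Sum>i\<in>J. (c(t := 0)) i *\<^sub>R w i) = (\<Sum>i\<in>J. c i *\<^sub>R w i)"
      using assms by (intro sum.cong) auto
    then have "(\<Sum>i\<in>insert t J. (c(t := 0)) i *\<^sub>R w i) = 0"
      using c assms by simp
    then have "(c(t := 0)) i = 0"
      using indep_familyD[OF ind] c(2) by blast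
    then show "c i = 0"
      using c(2) assms(2) by (auto split: if_splits)
  qed
  show "w t \<notin> span (w ` J)"
  proof
    assume "w t \<in> span (w ` J)"
    then obtain c where c: "w t = (\<Sum>j\<in>J. c j *\<^sub>R w j)"
      unfolding span_image_sums[OF assms(1)] by blast
    have "(\<Sum>i\<in>J. (c(t := -1)) i *\<^sub>R w i) = (\<Sum>i\<in>J. c i *\<^sub>R w i)"
      using assms by (intro sum.cong) auto
    then have "(\<Sum>i\<in>insert t J. (c(t := -1)) i *\<^sub>R w i) = 0"
      using c assms by simp
    then have "(c(t := -1)) t = 0"
      using indep_familyD[OF ind] by blast
    then show False by simp
  qed
next
  assume *: "indep_family J w \<and> w t \<notin> span (w ` J)"
  show "indep_family (insert t J) w"
    unfolding indep_family_def
  proof (intro allI impI)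
    fix c assume "(\<Sum>i\<in>insert t J. c i *\<^sub>R w i) = 0"
    then have c: "c t *\<^sub>R w t + (\<Sum>i\<in>J. c i *\<^sub>R w i) = 0"
      using assms by simp
    have "c t = 0"
    proof (rule ccontr)
      assume "c t \<noteq> 0"
      have "(- 1 / c t) *\<^sub>R (\<Sum>i\<in>J. c i *\<^sub>R w i) \<in> span (w ` J)"
        by (intro span_scale span_sum span_base) auto
      moreover have "(\<Sum>i\<in>J. c i *\<^sub>R w i) = - (c t *\<^sub>R w t)"
        using c by (simp add: eq_neg_iff_add_eq_0 add.commute)
      ultimately show False
        using * \<open>c t \<noteq> 0\<close> by simp
    qed
    then show "\<forall>i\<in>insert t J. c i = 0"
      using c * unfolding indep_family_def by auto
  qed
qed

lemma indep_family_cong: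
  assumes "\<And>i. i \<in> I \<Longrightarrow> v i = w i"
  shows "indep_family I v \<longleftrightarrow> indep_family I w"
proof -
  have "(\<Sum>i\<in>I. c i *\<^sub>R v i) = (\<Sum>i\<in>I. c i *\<^sub>R w i)" for c
    using assms by (intro sum.cong) auto
  then show ?thesis
    by (simp add: indep_family_def)
qed

section \<open>Simplicial cones over arbitrary index sets and their indicator functions\<close>

definition cone_on :: "'i set \<Rightarrow> ('i \<Rightarrow> 'a::real_vector) \<Rightarrow> 'a set" where
  "cone_on I w = {\<Sum>i\<in>I. c i *\<^sub>R w i | c. \<forall>i\<in>I. 0 \<le> c i}"

lemma cone_on_cong:
  assumes "\<And>i. i \<in> I \<Longrightarrow> v i = w i"
  shows "cone_on I v = cone_on I w"
proof -
  have "(\<Sum>i\<in>I. c i *\<^sub>R v i) = (\<Sum>i\<in>I. c i *\<^sub>R w i)" for c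
    using assms by (intro sum.cong) auto
  then show ?thesis
    by (simp add: cone_on_def)
qed

lemma sum_mem_cone_on_iff:
  assumes "indep_family I w"
  shows "(\<Sum>i\<in>I. c i *\<^sub>R w i) \<in> cone_on I w \<longleftrightarrow> (\<forall>i\<in>I. 0 \<le> c i)"
proof
  assume "(\<Sum>i\<in>I. c i *\<^sub>R w i) \<in> cone_on I w"
  then obtain d where d: "(\<Sum>i\<in>I. c i *\<^sub>R w i) = (\<Sum>i\<in>I. d i *\<^sub>R w i)" "\<forall>i\<in>I. 0 \<le> d i"
    by (auto simp: cone_on_def)
  then have "(\<Sum>i\<in>I. (c i - d i) *\<^sub>R w i) = 0"
    by (simp add: scaleR_diff_left sum_subtractf)
  then have "\<forall>i\<in>I. c i - d i = 0"
    using indep_familyD[OF assms, of "\<lambda>i. c i - d i"] by blast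
  then show "\<forall>i\<in>I. 0 \<le> c i"
    using d(2) by auto
qed (auto simp: cone_on_def)

text \<open>The coefficient of \<open>w t\<close> is determined modulo the span of the other
  generators, so membership splits into a condition on the base and a condition on \<open>r\<close>.
  This carries a decomposition of the base up by one dimension.\<close>

lemma cone_on_insert_iff:
  assumes "finite J" "t \<notin> J" "w t \<notin> span (w ` J)" "h \<in> span (w ` J)"
  shows "h + r *\<^sub>R w t \<in> cone_on (insert t J) w \<longleftrightarrow> h \<in> cone_on J w \<and> 0 \<le> r"
proof
  assume "h + r *\<^sub>R w t \<in> cone_on (insert t J) w"
  then obtain c where c: "h + r *\<^sub>R w t = (\<Sum>i\<in>J. c i *\<^sub>R w i) + c t *\<^sub>R w t"
      "\<forall>i\<in>J. 0 \<le> c i" "0 \<le> c t"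
    using assms by (auto simp: cone_on_def add.commute)
  let ?s = "\<Sum>i\<in>J. c i *\<^sub>R w i"
  have s: "?s \<in> span (w ` J)"
    by (intro span_sum span_scale span_base) auto
  have eq: "(c t - r) *\<^sub>R w t = h - ?s"
    using c(1) by (simp add: algebra_simps)
  have "c t = r"
  proof (rule ccontr)
    assume "c t \<noteq> r"
    then have "w t = (1 / (c t - r)) *\<^sub>R (h - ?s)"
      by (simp flip: eq)
    then show False
      using assms(3,4) s by (metis span_diff span_scale)
  qed
  then show "h \<in> cone_on J w \<and> 0 \<le> r"
    using c eq by (auto simp: cone_on_def)
next
  assume "h \<in> cone_on J w \<and> 0 \<le> r"
  then obtain c where c: "h = (\<Sum>i\<in>J. c i *\<^sub>R w i)" "\<forall>i\<in>J. 0 \<le> c i" "0 \<le> r"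
    by (auto simp: cone_on_def)
  have "(\<Sum>i\<in>J. (c(t := r)) i *\<^sub>R w i) = h"
    unfolding c(1) using assms(2) by (intro sum.cong) auto
  then have "h + r *\<^sub>R w t = (\<Sum>i\<in>insert t J. (c(t := r)) i *\<^sub>R w i)"
    using assms(1,2) by simp
  then show "h + r *\<^sub>R w t \<in> cone_on (insert t J) w"
    unfolding cone_on_def using c by (intro CollectI exI[of _ "c(t := r)"]) auto
qed

text \<open>With no vanishing coordinate, weak and strict positivity agree. The strict form turns
  the indicator into a product whose factors \<open>a j\<close> become \<open>1 - a j\<close> under
  a sign flip.\<close>

lemma indicator_cone_on_generic:
  assumes "finite I" "indep_family I w" "\<And>i. i \<in> I \<Longrightarrow> c i \<noteq> 0"
  shows "indicator (cone_on I w) (\<Sum>i\<in>I. c i *\<^sub>R w i) = (\<Prod>i\<in>I. of_bool (0 < c i) :: real)"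
proof (cases "\<forall>i\<in>I. 0 \<le> c i")
  case True
  then have "0 < c i" if "i \<in> I" for i
    using assms(3)[OF that] that by force
  then show ?thesis
    using True sum_mem_cone_on_iff[OF assms(2), of c] by simp
next
  case False
  then have "(\<Prod>i\<in>I. of_bool (0 < c i) :: real) = 0"
    using assms(1) by (intro prod_zero) force+
  then show ?thesis
    using False sum_mem_cone_on_iff[OF assms(2), of c] by simp
qed

text \<open>Let \<open>t i\<close> be the product of \<open>1 - a j\<close> over
  \<open>j < i\<close> and of \<open>a j\<close> over \<open>j \<ge> i\<close>. Deleting the factor
  at \<open>i\<close> gives the sum of \<open>t i\<close> and the next such product, because
  \<open>a i + (1 - a i) = 1\<close>; the alternating sum therefore telescopes.\<close>

lemma alternating_sum_telescope:
  fixes a :: "'i::linorder \<Rightarrow> real"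
  assumes "finite P"
  shows "(\<Sum>i\<in>P. (-1) ^ card {j\<in>P. j < i} * (\<Prod>j\<in>P - {i}. if j < i then 1 - a j else a j)) =
    (\<Prod>j\<in>P. a j) - (-1) ^ card P * (\<Prod>j\<in>P. 1 - a j)"
  using assms
proof (induction rule: finite_linorder_max_induct)
  case (insert b A)
  have b: "b \<notin> A" using insert.hyps by auto
  \<comment> \<open>A new maximum \<open>b\<close> contributes the factor \<open>a b\<close> to
    every earlier summand; its own summand has all other factors flipped.\<close>
  have old: "(-1) ^ card {j\<in>insert b A. j < i} * (\<Prod>j\<in>insert b A - {i}. if j < i then 1 - a j else a j) =
    a b * ((-1) ^ card {j\<in>A. j < i} * (\<Prod>j\<in>A - {i}. if j < i then 1 - a j else a j))" if "i \<in> A" for i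
  proof -
    have "{j\<in>insert b A. j < i} = {j\<in>A. j < i}" "insert b A - {i} = insert b (A - {i})" "\<not> b < i"
      using insert.hyps(2) that b by force+
    then show ?thesis
      using insert.hyps(1) b by simp
  qed
  have new: "{j\<in>insert b A. j < b} = A" "insert b A - {b} = A"
    "(\<Prod>j\<in>A. if j < b then 1 - a j else a j) = (\<Prod>j\<in>A. 1 - a j)"
    using insert.hyps(2) b by (auto intro: prod.cong)
  have "(\<Sum>i\<in>insert b A. (-1) ^ card {j\<in>insert b A. j < i} * (\<Prod>j\<in>insert b A - {i}. if j < i then 1 - a j else a j)) =
    (-1) ^ card A * (\<Prod>j\<in>A. 1 - a j) +
    (\<Sum>i\<in>A. a b * ((-1) ^ card {j\<in>A. j < i} * (\<Prod>j\<in>A - {i}. if j < i then 1 - a j else a j)))"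
    unfolding sum.insert[OF insert.hyps(1) b] new by (simp only: old cong: sum.cong)
  also have "\<dots> = (-1) ^ card A * (\<Prod>j\<in>A. 1 - a j) + a b * ((\<Prod>j\<in>A. a j) - (-1) ^ card A * (\<Prod>j\<in>A. 1 - a j))"
    unfolding sum_distrib_left[symmetric] insert.IH ..
  also have "\<dots> = (\<Prod>j\<in>insert b A. a j) - (-1) ^ card (insert b A) * (\<Prod>j\<in>insert b A. 1 - a j)"
    using insert.hyps(1) b by (simp add: algebra_simps)
  finally show ?case .
qed simp

text \<open>Comparing with \<open>\<phi> i\<close> instead of \<open>\<Phi>\<close> makes the
  pattern independent of the point: for the indices that contribute, both signs agree.\<close>

definition flip_sign :: "('i::linorder \<Rightarrow> real) \<Rightarrow> 'i \<Rightarrow> 'i \<Rightarrow> real" where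
  "flip_sign \<phi> i j = (if j < i \<and> sgn (\<phi> j) = sgn (\<phi> i) then -1 else 1)"

lemma flip_sign_square [simp]: "flip_sign \<phi> i j * flip_sign \<phi> i j = 1"
  by (simp add: flip_sign_def)

text \<open>Write \<open>\<Phi> = \<Sum>j. \<phi> j * x j\<close>. Only the indices \<open>i\<close> with \<open>sgn (\<phi> i) = sgn \<Phi>\<close> contribute, and the
  \<open>i\<close>-th term leaves the sign of \<open>x i\<close> free. Flipping these signs one after another, the sum telescopes;
  the final sign pattern is impossible, since it would give \<open>\<Phi>\<close> the wrong sign.\<close>

lemma orthant_identity:
  fixes x \<phi> :: "'i::linorder \<Rightarrow> real"
  assumes J: "finite J" and x: "\<And>j. j \<in> J \<Longrightarrow> x j \<noteq> 0" and \<Phi>: "\<Phi> = (\<Sum>j\<in>J. \<phi> j * x j)" "\<Phi> \<noteq> 0"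
  shows "(\<Prod>j\<in>J. of_bool (0 < x j) :: real) =
    (\<Sum>i\<in>{i\<in>J. \<phi> i \<noteq> 0}. (-1) ^ card {j\<in>J. j < i \<and> sgn (\<phi> j) = sgn (\<phi> i)} *
       (of_bool (0 < \<Phi> / \<phi> i) * (\<Prod>j\<in>J - {i}. of_bool (0 < flip_sign \<phi> i j * x j))))"
proof -
  \<comment> \<open>Only these indices contribute: \<open>\<Phi> / \<phi> i\<close> is positive
    exactly for them.\<close>
  define P where "P = {j\<in>J. sgn (\<phi> j) = sgn \<Phi>}"
  define a where "a = (\<lambda>j. of_bool (0 < x j) :: real)"
  have P: "finite P" "P \<subseteq> J"
    using J by (auto simp: P_def)
  have na: "of_bool (0 < - x j) = 1 - a j" if "j \<in> J" for j
    using x[OF that] by (auto simp: a_def)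
  have split: "(\<Prod>j\<in>J. f j) = (\<Prod>j\<in>J - P. f j) * (\<Prod>j\<in>P. f j)" for f :: "'i \<Rightarrow> real"
    using P J by (metis prod.subset_diff)
  have zero: "(\<Prod>j\<in>J - P. a j) * (\<Prod>j\<in>P. 1 - a j) = 0"
  proof (rule ccontr)
    assume "(\<Prod>j\<in>J - P. a j) * (\<Prod>j\<in>P. 1 - a j) \<noteq> 0"
    then have ne: "\<forall>j\<in>J - P. a j \<noteq> 0" "\<forall>j\<in>P. 1 - a j \<noteq> 0"
      using P J by (auto simp: prod_zero_iff)
    \<comment> \<open>Here the coordinates in \<open>P\<close> are negative and those outside
      \<open>P\<close> positive, so no summand of \<open>\<Phi>\<close> has the sign of
      \<open>\<Phi>\<close>.\<close>
    have "sgn \<Phi> * (\<phi> j * x j) \<le> 0" if "j \<in> J" for j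
    proof (cases "j \<in> P")
      case True
      then have "x j < 0"
        using ne(2) x[OF that] by (auto simp: a_def)
      moreover have "0 \<le> sgn \<Phi> * \<phi> j"
        using True by (simp add: P_def) (metis abs_ge_zero abs_sgn mult.commute)
      ultimately show ?thesis
        by (simp add: mult.assoc[symmetric] mult_nonneg_nonpos)
    next
      case False
      then have "0 < x j"
        using ne(1) that by (auto simp: a_def)
      moreover have "sgn \<Phi> * \<phi> j \<le> 0"
        using False that \<Phi>(2) by (auto simp: P_def sgn_if split: if_splits)
      ultimately show ?thesis
        by (simp add: mult.assoc[symmetric] mult_nonpos_nonneg)
    qed
    then have "sgn \<Phi> * \<Phi> \<le> 0"
      unfolding \<Phi>(1) sum_distrib_left using \<Phi>(1) by (intro sum_nonpos) simp
    then show False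
      using \<Phi>(2) by (simp add: sgn_if split: if_splits)
  qed
  have "(\<Sum>i\<in>{i\<in>J. \<phi> i \<noteq> 0}. (-1 :: real) ^ card {j\<in>J. j < i \<and> sgn (\<phi> j) = sgn (\<phi> i)} *
       (of_bool (0 < \<Phi> / \<phi> i) * (\<Prod>j\<in>J - {i}. of_bool (0 < flip_sign \<phi> i j * x j)))) =
    (\<Sum>i\<in>P. (-1) ^ card {j\<in>J. j < i \<and> sgn (\<phi> j) = sgn (\<phi> i)} *
       (of_bool (0 < \<Phi> / \<phi> i) * (\<Prod>j\<in>J - {i}. of_bool (0 < flip_sign \<phi> i j * x j))))"
  proof (rule sum.mono_neutral_right)
    show "P \<subseteq> {i\<in>J. \<phi> i \<noteq> 0}"
      using \<Phi>(2) by (auto simp: P_def sgn_0_0)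
    show "\<forall>i\<in>{i\<in>J. \<phi> i \<noteq> 0} - P. (-1) ^ card {j\<in>J. j < i \<and> sgn (\<phi> j) = sgn (\<phi> i)} *
       (of_bool (0 < \<Phi> / \<phi> i) * (\<Prod>j\<in>J - {i}. of_bool (0 < flip_sign \<phi> i j * x j))) = (0::real)"
      using \<Phi>(2) by (auto simp: P_def sgn_if zero_less_divide_iff split: if_splits)
  qed (use J in simp)
  also have "\<dots> = (\<Sum>i\<in>P. (\<Prod>j\<in>J - P. a j) *
      ((-1) ^ card {j\<in>P. j < i} * (\<Prod>j\<in>P - {i}. if j < i then 1 - a j else a j)))"
  proof (rule sum.cong[OF refl])
    fix i assume i: "i \<in> P"
    \<comment> \<open>For \<open>i\<close> in \<open>P\<close> the flipped indices are precisely
      those of \<open>P\<close> before \<open>i\<close>; the factors over \<open>J - P\<close> are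
      common to all summands.\<close>
    have "{j\<in>J. j < i \<and> sgn (\<phi> j) = sgn (\<phi> i)} = {j\<in>P. j < i}"
      using i by (auto simp: P_def)
    moreover have "0 < \<Phi> / \<phi> i"
      using i \<Phi>(2) by (auto simp: P_def sgn_if zero_less_divide_iff split: if_splits)
    moreover have "(\<Prod>j\<in>J - {i}. of_bool (0 < flip_sign \<phi> i j * x j)) =
        (\<Prod>j\<in>J - P. a j) * (\<Prod>j\<in>P - {i}. if j < i then 1 - a j else a j)"
    proof -
      have "J - {i} = (J - P) \<union> (P - {i})"
        using P i by auto
      then have "(\<Prod>j\<in>J - {i}. of_bool (0 < flip_sign \<phi> i j * x j) :: real) =
        (\<Prod>j\<in>J - P. of_bool (0 < flip_sign \<phi> i j * x j)) * (\<Prod>j\<in>P - {i}. of_bool (0 < flip_sign \<phi> i j * x j))"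
        by (simp only:) (rule prod.union_disjoint, use J P in auto)
      also have "(\<Prod>j\<in>J - P. of_bool (0 < flip_sign \<phi> i j * x j)) = (\<Prod>j\<in>J - P. a j)"
        using i by (intro prod.cong) (auto simp: flip_sign_def P_def a_def)
      also have "(\<Prod>j\<in>P - {i}. of_bool (0 < flip_sign \<phi> i j * x j)) =
          (\<Prod>j\<in>P - {i}. if j < i then 1 - a j else a j)"
      proof (rule prod.cong[OF refl])
        fix j assume "j \<in> P - {i}"
        then have "j \<in> J" "sgn (\<phi> j) = sgn (\<phi> i)"
          using i by (auto simp: P_def)
        then show "of_bool (0 < flip_sign \<phi> i j * x j) = (if j < i then 1 - a j else a j)"
          using na[of j] by (simp add: flip_sign_def a_def)
      qed
      finally show ?thesis .
    qed
    ultimately show "(-1) ^ card {j\<in>J. j < i \<and> sgn (\<phi> j) = sgn (\<phi> i)} *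
       (of_bool (0 < \<Phi> / \<phi> i) * (\<Prod>j\<in>J - {i}. of_bool (0 < flip_sign \<phi> i j * x j))) =
      (\<Prod>j\<in>J - P. a j) * ((-1) ^ card {j\<in>P. j < i} * (\<Prod>j\<in>P - {i}. if j < i then 1 - a j else a j))"
      by simp
  qed
  also have "\<dots> = (\<Prod>j\<in>J - P. a j) * ((\<Prod>j\<in>P. a j) - (-1) ^ card P * (\<Prod>j\<in>P. 1 - a j))"
    unfolding sum_distrib_left[symmetric] alternating_sum_telescope[OF P(1)] ..
  also have "\<dots> = (\<Prod>j\<in>J - P. a j) * (\<Prod>j\<in>P. a j)"
    using zero by (simp add: algebra_simps)
  also have "\<dots> = (\<Prod>j\<in>J. of_bool (0 < x j))"
    using split[of a] by (simp add: a_def)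
  finally show ?thesis by simp
qed

section \<open>Cones with all but one generator in a hyperplane\<close>

lemma dim_span_image_le:
  fixes w :: "'i \<Rightarrow> 'a::euclidean_space"
  assumes "finite J"
  shows "dim (span (w ` J)) \<le> card J"
proof -
  have "dim (span (w ` J)) \<le> card (w ` J)"
    using assms by (simp add: dim_le_card')
  also have "\<dots> \<le> card J"
    using assms by (rule card_image_le)
  finally show ?thesis .
qed

text \<open>Here \<open>\<phi> j\<close> is the value of a linear functional at \<open>w j\<close>:
  if \<open>\<phi> i \<noteq> 0\<close>, subtracting the multiple of \<open>w i\<close> projects
  \<open>w j\<close> along \<open>w i\<close> onto the kernel. In this basis the coordinate at
  \<open>i\<close> is \<open>\<Phi> / \<phi> i\<close>, and the others are those for
  \<open>w\<close> up to the flips.\<close>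

definition flip_family :: "('i::linorder \<Rightarrow> real) \<Rightarrow> ('i \<Rightarrow> 'a::real_vector) \<Rightarrow> 'i \<Rightarrow> 'i \<Rightarrow> 'a" where
  "flip_family \<phi> w i j =
     (if j = i then w i else flip_sign \<phi> i j *\<^sub>R (w j - (\<phi> j / \<phi> i) *\<^sub>R w i))"

text \<open>Apart from signs, the change of basis alters only the coefficient of \<open>w i\<close>.
  This triangular shape yields both independence and the coordinates used in the
  decomposition.\<close>

lemma sum_flip_family:
  fixes \<phi> :: "'i::linorder \<Rightarrow> real"
  assumes "finite J" "i \<in> J"
  shows "(\<Sum>j\<in>J. c j *\<^sub>R flip_family \<phi> w i j) =
    (\<Sum>j\<in>J - {i}. (flip_sign \<phi> i j * c j) *\<^sub>R w j) +
    (c i - (\<Sum>j\<in>J - {i}. flip_sign \<phi> i j * c j * (\<phi> j / \<phi> i))) *\<^sub>R w i"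
proof -
  have "(\<Sum>j\<in>J. c j *\<^sub>R flip_family \<phi> w i j) =
    c i *\<^sub>R w i + (\<Sum>j\<in>J - {i}. c j *\<^sub>R flip_family \<phi> w i j)"
    using assms by (subst sum.remove[of _ i]) (auto simp: flip_family_def)
  also have "(\<Sum>j\<in>J - {i}. c j *\<^sub>R flip_family \<phi> w i j) =
    (\<Sum>j\<in>J - {i}. (flip_sign \<phi> i j * c j) *\<^sub>R w j - (flip_sign \<phi> i j * c j * (\<phi> j / \<phi> i)) *\<^sub>R w i)"
    by (intro sum.cong) (auto simp: flip_family_def scaleR_diff_right mult_ac)
  finally show ?thesis
    by (simp add: sum_subtractf scaleR_diff_left scaleR_sum_left)
qed

lemma indep_flip_family:
  assumes "finite J" "i \<in> J" "indep_family J w"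
  shows "indep_family J (flip_family \<phi> w i)"
  unfolding indep_family_def
proof (intro allI impI)
  fix c assume c: "(\<Sum>j\<in>J. c j *\<^sub>R flip_family \<phi> w i j) = 0"
  \<comment> \<open>These are the coordinates with respect to \<open>w\<close>. Their vanishing off
    \<open>i\<close> kills \<open>c\<close> there, hence also the correction sum, and then
    \<open>c i\<close>.\<close>
  define d where "d = (\<lambda>j. if j = i then c i - (\<Sum>j\<in>J - {i}. flip_sign \<phi> i j * c j * (\<phi> j / \<phi> i))
    else flip_sign \<phi> i j * c j)"
  have "(\<Sum>j\<in>J. d j *\<^sub>R w j) = d i *\<^sub>R w i + (\<Sum>j\<in>J - {i}. d j *\<^sub>R w j)"
    using assms(1,2) by (rule sum.remove)
  also have "(\<Sum>j\<in>J - {i}. d j *\<^sub>R w j) = (\<Sum>j\<in>J - {i}. (flip_sign \<phi> i j * c j) *\<^sub>R w j)"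
    by (intro sum.cong) (auto simp: d_def)
  also have "d i *\<^sub>R w i + \<dots> = (\<Sum>j\<in>J. c j *\<^sub>R flip_family \<phi> w i j)"
    unfolding sum_flip_family[OF assms(1,2)] by (simp add: d_def add.commute)
  finally have d: "d j = 0" if "j \<in> J" for j
    using c indep_familyD[OF assms(3)] that by simp
  have z: "c j = 0" if "j \<in> J - {i}" for j
    using d[of j] that by (auto simp: d_def flip_sign_def split: if_splits)
  moreover have "c i = 0"
    using d[OF assms(2)] z by (simp add: d_def)
  ultimately show "\<forall>j\<in>J. c j = 0"
    by blast
qed

lemma span_flip_family:
  assumes "i \<in> J"
  shows "span (flip_family \<phi> w i ` J) = span (w ` J)"
  unfolding span_eq
proof
  have "w j \<in> span (w ` J)" if "j \<in> J" for j
    using that by (auto intro: span_base)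
  then show "flip_family \<phi> w i ` J \<subseteq> span (w ` J)"
    using assms by (auto simp: flip_family_def intro!: span_scale span_diff)
  show "w ` J \<subseteq> span (flip_family \<phi> w i ` J)"
  proof
    fix y assume "y \<in> w ` J"
    then obtain j where j: "j \<in> J" "y = w j" by blast
    have i: "w i = flip_family \<phi> w i i"
      by (simp add: flip_family_def)
    show "y \<in> span (flip_family \<phi> w i ` J)"
    proof (cases "j = i")
      case True
      then show ?thesis
        using j i by (auto intro: span_base)
    next
      case False
      then have y: "y = flip_sign \<phi> i j *\<^sub>R flip_family \<phi> w i j + (\<phi> j / \<phi> i) *\<^sub>R flip_family \<phi> w i i"
        using j by (simp add: flip_family_def)
      show ?thesis
        unfolding y using j(1) assms by (intro span_add span_scale span_base imageI)
    qed
  qed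
qed

lemma flip_family_orthogonal:
  assumes "w i \<bullet> z \<noteq> 0" "j \<noteq> i"
  shows "flip_family (\<lambda>j. w j \<bullet> z) w i j \<bullet> z = 0"
  using assms by (simp add: flip_family_def inner_diff_left)

text \<open>This is \<open>orthant_identity\<close> read in coordinates. The exceptional subspaces
  are the kernel of the functional inside the span and the spans of all generators but one; off them
  \<open>\<Phi>\<close> and every coordinate are nonzero.\<close>

lemma cone_on_flip_decomposition:
  fixes w :: "'i::linorder \<Rightarrow> 'a::euclidean_space"
  assumes J: "finite J" "indep_family J w" and ne: "\<exists>i\<in>J. w i \<bullet> z \<noteq> 0"
  shows "\<exists>\<H>. finite \<H> \<and> (\<forall>S\<in>\<H>. dim S < card J) \<and>
    (\<forall>h\<in>span (w ` J) - \<Union>\<H>. indicat_real (cone_on J w) h =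
      (\<Sum>i\<in>{i\<in>J. w i \<bullet> z \<noteq> 0}. (-1) ^ card {j\<in>J. j < i \<and> sgn (w j \<bullet> z) = sgn (w i \<bullet> z)} *
        indicat_real (cone_on J (flip_family (\<lambda>j. w j \<bullet> z) w i)) h))"
proof (intro exI conjI ballI)
  let ?\<phi> = "\<lambda>j. w j \<bullet> z"
  let ?K = "span (w ` J) \<inter> {x. z \<bullet> x = 0}"
  let ?\<H> = "insert ?K ((\<lambda>j. span (w ` (J - {j}))) ` J)"
  show "finite ?\<H>"
    using J by simp
  fix S assume S: "S \<in> ?\<H>"
  obtain i where i: "i \<in> J" "w i \<bullet> z \<noteq> 0"
    using ne by blast
  have K: "subspace ?K"
    by (intro subspace_inter subspace_span subspace_hyperplane)
  \<comment> \<open>The generator \<open>w i\<close> with nonzero inner product shows that the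
    kernel is a proper subspace.\<close>
  have "?K \<subset> span (w ` J)"
  proof -
    have "w i \<in> span (w ` J)" "w i \<notin> ?K"
      using i by (auto simp: inner_commute intro: span_base)
    then show ?thesis by blast
  qed
  then have "dim ?K < dim (span (w ` J))"
    using K by (intro dim_psubset) (simp add: span_eq_iff[THEN iffD2])
  also have "\<dots> \<le> card J"
    using J by (intro dim_span_image_le)
  finally have "dim ?K < card J" .
  moreover have "dim (span (w ` (J - {j}))) < card J" if "j \<in> J" for j
    using J(1) by (intro order.strict_trans1[OF dim_span_image_le card_Diff1_less[OF J(1) that]]) simp
  ultimately show "dim S < card J"
    using S by auto
next
  let ?\<phi> = "\<lambda>j. w j \<bullet> z"
  let ?\<H> = "insert (span (w ` J) \<inter> {x. z \<bullet> x = 0}) ((\<lambda>j. span (w ` (J - {j}))) ` J)"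
  fix h assume h: "h \<in> span (w ` J) - \<Union>?\<H>"
  then obtain x where x: "h = (\<Sum>j\<in>J. x j *\<^sub>R w j)"
    unfolding span_image_sums[OF J(1)] by blast
  define \<Phi> where "\<Phi> = (\<Sum>j\<in>J. ?\<phi> j * x j)"
  have "h \<bullet> z = \<Phi>"
    by (simp add: x \<Phi>_def inner_sum_left mult.commute)
  then have \<Phi>: "\<Phi> \<noteq> 0"
    using h by (auto simp: inner_commute)
  have x0: "x j \<noteq> 0" if "j \<in> J" for j
  proof
    assume "x j = 0"
    then have "h = (\<Sum>k\<in>J - {j}. x k *\<^sub>R w k)"
      unfolding x using J(1) that by (subst sum.remove) auto
    also have "\<dots> \<in> span (w ` (J - {j}))"
      by (intro span_sum span_scale span_base) auto
    finally show False
      using h that by auto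
  qed
  have flip: "indicat_real (cone_on J (flip_family ?\<phi> w i)) h =
      of_bool (0 < \<Phi> / ?\<phi> i) * (\<Prod>j\<in>J - {i}. of_bool (0 < flip_sign ?\<phi> i j * x j))"
    if i: "i \<in> J" "?\<phi> i \<noteq> 0" for i
  proof -
    \<comment> \<open>The coordinates of \<open>h\<close> with respect to the flipped family. A flip
      is its own inverse, so applying it again recovers \<open>x j\<close>.\<close>
    define y where "y = (\<lambda>j. if j = i then \<Phi> / ?\<phi> i else flip_sign ?\<phi> i j * x j)"
    have fy: "flip_sign ?\<phi> i j * y j = x j" if "j \<in> J - {i}" for j
      using that by (simp add: y_def mult.assoc[symmetric])
    have "(\<Sum>j\<in>J - {i}. flip_sign ?\<phi> i j * y j * (?\<phi> j / ?\<phi> i)) = (\<Sum>j\<in>J - {i}. ?\<phi> j * x j) / ?\<phi> i"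
      unfolding sum_divide_distrib by (rule sum.cong[OF refl], simp only: fy times_divide_eq_right) (simp only: mult.commute)
    also have "\<dots> = (\<Phi> - ?\<phi> i * x i) / ?\<phi> i"
      using J(1) i(1) by (simp add: \<Phi>_def sum.remove)
    finally have yi: "y i - (\<Sum>j\<in>J - {i}. flip_sign ?\<phi> i j * y j * (?\<phi> j / ?\<phi> i)) = x i"
      using i(2) by (simp add: y_def diff_divide_distrib)
    have "(\<Sum>j\<in>J - {i}. (flip_sign ?\<phi> i j * y j) *\<^sub>R w j) = (\<Sum>j\<in>J - {i}. x j *\<^sub>R w j)"
      by (rule sum.cong[OF refl]) (simp only: fy)
    then have "(\<Sum>j\<in>J. y j *\<^sub>R flip_family ?\<phi> w i j) = (\<Sum>j\<in>J - {i}. x j *\<^sub>R w j) + x i *\<^sub>R w i"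
      unfolding sum_flip_family[OF J(1) i(1)] yi by (rule arg_cong2[where f = "(+)", OF _ refl])
    also have "\<dots> = h"
      unfolding x using J(1) i(1) by (simp add: sum.remove)
    finally have hy: "h = (\<Sum>j\<in>J. y j *\<^sub>R flip_family ?\<phi> w i j)" ..
    have y0: "y j \<noteq> 0" if "j \<in> J" for j
      using x0[OF that] \<Phi> i(2) by (simp add: y_def flip_sign_def)
    have "indicat_real (cone_on J (flip_family ?\<phi> w i)) h = (\<Prod>j\<in>J. of_bool (0 < y j))"
      unfolding hy by (intro indicator_cone_on_generic indep_flip_family J i y0)
    also have "\<dots> = of_bool (0 < y i) * (\<Prod>j\<in>J - {i}. of_bool (0 < y j))"
      using J(1) i(1) by (rule prod.remove)
    also have "(\<Prod>j\<in>J - {i}. of_bool (0 < y j) :: real) = (\<Prod>j\<in>J - {i}. of_bool (0 < flip_sign ?\<phi> i j * x j))"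
      by (rule prod.cong) (auto simp: y_def)
    finally show ?thesis
      by (simp add: y_def)
  qed
  have "indicat_real (cone_on J w) h = (\<Prod>j\<in>J. of_bool (0 < x j))"
    unfolding x by (intro indicator_cone_on_generic J x0)
  also have "\<dots> = (\<Sum>i\<in>{i\<in>J. ?\<phi> i \<noteq> 0}. (-1) ^ card {j\<in>J. j < i \<and> sgn (?\<phi> j) = sgn (?\<phi> i)} *
       (of_bool (0 < \<Phi> / ?\<phi> i) * (\<Prod>j\<in>J - {i}. of_bool (0 < flip_sign ?\<phi> i j * x j))))"
    by (rule orthant_identity) (use J(1) x0 \<Phi> \<Phi>_def in auto)
  also have "\<dots> = (\<Sum>i\<in>{i\<in>J. ?\<phi> i \<noteq> 0}. (-1) ^ card {j\<in>J. j < i \<and> sgn (?\<phi> j) = sgn (?\<phi> i)} *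
        indicat_real (cone_on J (flip_family ?\<phi> w i)) h)"
    by (rule sum.cong) (simp_all add: flip)
  finally show "indicat_real (cone_on J w) h =
      (\<Sum>i\<in>{i\<in>J. ?\<phi> i \<noteq> 0}. (-1) ^ card {j\<in>J. j < i \<and> sgn (?\<phi> j) = sgn (?\<phi> i)} *
        indicat_real (cone_on J (flip_family ?\<phi> w i)) h)" .
qed

text \<open>At most \<open>card J\<close> cones arise, one for each index that may become the new
  last generator; this is the factor gained at each level of the recursion.\<close>

lemma cone_on_decomposition_step:
  fixes w :: "'i::linorder \<Rightarrow> 'a::euclidean_space"
  assumes J: "finite J" "J \<noteq> {}" "indep_family J w"
  shows "\<exists>L s u \<H>. L \<subseteq> J \<and> (\<forall>i\<in>L. s i \<in> {-1, 1} \<and> indep_family J (u i) \<and>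
      span (u i ` J) = span (w ` J) \<and> (\<forall>j\<in>J - {i}. u i j \<bullet> z = 0)) \<and>
    finite \<H> \<and> (\<forall>S\<in>\<H>. dim S < card J) \<and>
    (\<forall>h\<in>span (w ` J) - \<Union>\<H>. indicat_real (cone_on J w) h =
      (\<Sum>i\<in>L. s i * indicat_real (cone_on J (u i)) h))"
proof (cases "\<exists>i\<in>J. w i \<bullet> z \<noteq> 0")
  case True
  obtain \<H> where \<H>: "finite \<H>" "\<forall>S\<in>\<H>. dim S < card J"
    "\<forall>h\<in>span (w ` J) - \<Union>\<H>. indicat_real (cone_on J w) h =
      (\<Sum>i\<in>{i\<in>J. w i \<bullet> z \<noteq> 0}. (-1) ^ card {j\<in>J. j < i \<and> sgn (w j \<bullet> z) = sgn (w i \<bullet> z)} *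
        indicat_real (cone_on J (flip_family (\<lambda>j. w j \<bullet> z) w i)) h)"
    using cone_on_flip_decomposition[OF J(1,3) True] by blast
  let ?s = "\<lambda>i. (-1) ^ card {j\<in>J. j < i \<and> sgn (w j \<bullet> z) = sgn (w i \<bullet> z)} :: real"
  have s: "?s i \<in> {-1, 1}" for i
    by (cases "even (card {j\<in>J. j < i \<and> sgn (w j \<bullet> z) = sgn (w i \<bullet> z)})") auto
  have "\<forall>i\<in>{i\<in>J. w i \<bullet> z \<noteq> 0}. ?s i \<in> {-1, 1} \<and> indep_family J (flip_family (\<lambda>j. w j \<bullet> z) w i) \<and>
      span (flip_family (\<lambda>j. w j \<bullet> z) w i ` J) = span (w ` J) \<and>
      (\<forall>j\<in>J - {i}. flip_family (\<lambda>j. w j \<bullet> z) w i j \<bullet> z = 0)"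
    using s J by (auto simp: indep_flip_family span_flip_family flip_family_orthogonal)
  moreover have "{i\<in>J. w i \<bullet> z \<noteq> 0} \<subseteq> J" by blast
  ultimately show ?thesis
    using \<H> by (intro exI[of _ "{i\<in>J. w i \<bullet> z \<noteq> 0}"] exI[of _ ?s] exI[of _ "flip_family (\<lambda>j. w j \<bullet> z) w"]
      exI[of _ \<H>] conjI)
next
  case False
  \<comment> \<open>All generators are orthogonal to \<open>z\<close> already, so the cone stays as
    it is and any index can serve as the distinguished one.\<close>
  obtain i where "i \<in> J"
    using J(2) by blast
  then show ?thesis
    using False J by (intro exI[of _ "{i}"] exI[of _ "\<lambda>_. 1"] exI[of _ "\<lambda>_. w"] exI[of _ "{}"]) auto
qed

section \<open>Chains of generators and the recursion on the dimension\<close>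

lemma chain_family_extend:
  fixes v :: "nat \<Rightarrow> 'a::real_inner"
  assumes v: "chain_family k v" and z: "norm z = 1" "\<And>j. j \<in> {1..<k} \<Longrightarrow> v j \<bullet> z = 0"
  shows "chain_family (Suc k) (v(Suc k := z))"
  unfolding chain_family_def
proof (intro conjI ballI impI)
  fix i assume "i \<in> {1..Suc k}"
  then show "norm ((v(Suc k := z)) i) = 1"
    using v z(1) by (auto simp: chain_family_def)
next
  fix i j assume ij: "i \<in> {1..Suc k}" "j \<in> {1..Suc k}" "2 \<le> \<bar>int i - int j\<bar>"
  consider "i \<in> {1..k}" "j \<in> {1..k}" | "i = Suc k" "j \<in> {1..<k}" | "j = Suc k" "i \<in> {1..<k}"
    using ij by (cases "i = Suc k"; cases "j = Suc k") auto
  then show "(v(Suc k := z)) i \<bullet> (v(Suc k := z)) j = 0"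
  proof cases
    case 1
    then show ?thesis
      using v ij(3) by (auto simp: chain_family_def)
  next
    case 2
    then show ?thesis
      using z(2)[of j] by (auto simp: inner_commute)
  next
    case 3
    then show ?thesis
      using z(2)[of i] by auto
  qed
qed

text \<open>The invariant of the recursion. Intermediate generators may have any positive norm,
  hence the normalization of \<open>w t\<close>; the span condition becomes property (c) for the
  full index set.\<close>

definition is_chain_of :: "'i set \<Rightarrow> 'i \<Rightarrow> ('i \<Rightarrow> 'a::real_inner) \<Rightarrow> (nat \<Rightarrow> 'a) \<Rightarrow> bool" where
  "is_chain_of I t w v \<longleftrightarrow> chain_family (card I) v \<and> indep_family {1..card I} v \<and>
     v (card I) = w t /\<^sub>R norm (w t) \<and> span (v ` {1..<card I}) = span (w ` (I - {t}))"

text \<open>The vectors below the top of the old chain span the same space as the \<open>u j\<close>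
  with \<open>j \<noteq> i\<close>, all orthogonal to \<open>w t\<close>. So only the old top, a
  multiple of \<open>u i\<close>, can have a nonzero inner product with the new vector.\<close>

lemma is_chain_of_extend:
  fixes w :: "'i \<Rightarrow> 'a::real_inner"
  assumes J: "finite J" "t \<notin> J" "i \<in> J" and wt: "w t \<notin> span (w ` J)"
    and u: "span (u ` J) = span (w ` J)" "\<forall>j\<in>J - {i}. u j \<bullet> w t = 0" "u i \<noteq> 0"
    and v: "is_chain_of J i u v"
  defines "v' \<equiv> v(Suc (card J) := w t /\<^sub>R norm (w t))"
  shows "is_chain_of (insert t J) t w v'"
    and "span (v ` {1..card J}) = span (w ` J)"
proof -
  have v: "chain_family (card J) v" "indep_family {1..card J} v"
      "v (card J) = u i /\<^sub>R norm (u i)" "span (v ` {1..<card J}) = span (u ` (J - {i}))"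
    using v by (auto simp: is_chain_of_def)
  have wt0: "w t \<noteq> 0"
    using wt span_zero by metis
  have "1 \<le> card J"
    using J by (metis One_nat_def Suc_leI card_gt_0_iff empty_iff)
  then have top: "{1..card J} = insert (card J) {1..<card J}"
    by auto
  have Ji: "J = insert i (J - {i})"
    using J(3) by blast
  have "span (v ` {1..card J}) = span (insert (u i /\<^sub>R norm (u i)) (v ` {1..<card J}))"
    unfolding top by (simp add: v(3))
  \<comment> \<open>Normalizing \<open>u i\<close> only rescales the coefficient \<open>k\<close> by
    \<open>norm (u i)\<close>.\<close>
  also have "\<dots> = span (insert (u i) (u ` (J - {i})))"
    unfolding span_insert v(4)
  proof (intro Collect_cong iffI; elim exE)
    fix x k assume "x - k *\<^sub>R (u i /\<^sub>R norm (u i)) \<in> span (u ` (J - {i}))"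
    then show "\<exists>k. x - k *\<^sub>R u i \<in> span (u ` (J - {i}))"
      by (intro exI[of _ "k / norm (u i)"]) (simp add: divide_inverse)
  next
    fix x k assume "x - k *\<^sub>R u i \<in> span (u ` (J - {i}))"
    then show "\<exists>k. x - k *\<^sub>R (u i /\<^sub>R norm (u i)) \<in> span (u ` (J - {i}))"
      using u(3) by (intro exI[of _ "k * norm (u i)"]) (simp add: mult.assoc)
  qed
  also have "insert (u i) (u ` (J - {i})) = u ` J"
    using J(3) by blast
  finally show sp: "span (v ` {1..card J}) = span (w ` J)"
    using u(1) by simp
  have orth: "v j \<bullet> (w t /\<^sub>R norm (w t)) = 0" if "j \<in> {1..<card J}" for j
  proof -
    have "v j \<in> span (u ` (J - {i}))"
      unfolding v(4)[symmetric] using that by (intro span_base) auto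
    moreover have "span (u ` (J - {i})) \<subseteq> {x. w t \<bullet> x = 0}"
      using u(2) by (intro span_minimal subspace_hyperplane) (auto simp: inner_commute)
    ultimately show ?thesis
      by (auto simp: inner_commute)
  qed
  have c: "card (insert t J) = Suc (card J)"
    using J by simp
  have eq: "v' j = v j" if "j \<in> {1..card J}" for j
    using that by (auto simp: v'_def)
  have img: "v' ` {1..card J} = v ` {1..card J}"
    using eq by (intro image_cong) auto
  have notin: "v' (Suc (card J)) \<notin> span (v' ` {1..card J})"
  proof
    assume "v' (Suc (card J)) \<in> span (v' ` {1..card J})"
    then have "norm (w t) *\<^sub>R (w t /\<^sub>R norm (w t)) \<in> span (w ` J)"
      unfolding img sp by (intro span_scale[of "w t /\<^sub>R norm (w t)"]) (simp add: v'_def)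
    moreover have "norm (w t) *\<^sub>R (w t /\<^sub>R norm (w t)) = w t"
      using wt0 by simp
    ultimately show False
      using wt by (simp only:)
  qed
  have "{1..Suc (card J)} = insert (Suc (card J)) {1..card J}"
    by auto
  moreover have "indep_family {1..card J} v'"
    using indep_family_cong[of "{1..card J}" v' v] eq v(2) by simp
  ultimately have "indep_family {1..Suc (card J)} v'"
    using notin by (simp add: indep_family_insert_iff)
  moreover have "chain_family (Suc (card J)) v'"
    unfolding v'_def using wt0 orth v(1) by (intro chain_family_extend) auto
  moreover have "span (v' ` {1..<Suc (card J)}) = span (w ` J)"
    using img sp by (simp add: atLeastLessThanSuc_atLeastAtMost)
  moreover have "insert t J - {t} = J"
    using J(2) by blast
  ultimately show "is_chain_of (insert t J) t w v'"
    unfolding is_chain_of_def c by (simp add: v'_def)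
qed

lemma sum_list_concat_map:
  "sum_list (concat (map f xs)) = (\<Sum>x\<leftarrow>xs. sum_list (f x :: 'b::monoid_add list))"
  by (induction xs) auto

text \<open>Every cone in a decomposition of the base acquires the same factor
  \<open>of_bool (0 \<le> r)\<close>, which is also the factor for the decomposed cone; a positive
  scaling of the new generator does not affect it.\<close>

lemma indicator_cone_on_extend:
  fixes v :: "nat \<Rightarrow> 'a::real_vector"
  assumes "z \<noteq> 0" "z \<notin> span (v ` {1..k})" "h \<in> span (v ` {1..k})" "0 < (a::real)"
  shows "indicat_real (cone_on {1..Suc k} (v(Suc k := z /\<^sub>R a))) (h + r *\<^sub>R z) =
    of_bool (0 \<le> r) * indicat_real (cone_on {1..k} v) h"
proof -
  let ?v = "v(Suc k := z /\<^sub>R a)"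
  have img: "?v ` {1..k} = v ` {1..k}"
    by (intro image_cong) auto
  have cone: "cone_on {1..k} ?v = cone_on {1..k} v"
    by (intro cone_on_cong) auto
  have "?v (Suc k) \<notin> span (?v ` {1..k})"
  proof
    assume "?v (Suc k) \<in> span (?v ` {1..k})"
    then have "a *\<^sub>R (z /\<^sub>R a) \<in> span (v ` {1..k})"
      unfolding img by (intro span_scale[of "z /\<^sub>R a"]) simp
    moreover have "a *\<^sub>R (z /\<^sub>R a) = z"
      using assms(4) by simp
    ultimately show False
      using assms(2) by (simp only:)
  qed
  then have "h + (r * a) *\<^sub>R ?v (Suc k) \<in> cone_on (insert (Suc k) {1..k}) ?v \<longleftrightarrow>
      h \<in> cone_on {1..k} ?v \<and> 0 \<le> r * a"
    using assms(3) unfolding img[symmetric] by (intro cone_on_insert_iff) auto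
  moreover have "(r * a) *\<^sub>R ?v (Suc k) = r *\<^sub>R z"
    using assms(4) by (simp add: mult.assoc)
  moreover have "insert (Suc k) {1..k} = {1..Suc k}"
    by auto
  moreover have "0 \<le> r * a \<longleftrightarrow> 0 \<le> r"
    using assms(4) by (simp add: zero_le_mult_iff)
  ultimately have "h + r *\<^sub>R z \<in> cone_on {1..Suc k} ?v \<longleftrightarrow> h \<in> cone_on {1..k} v \<and> 0 \<le> r"
    by (simp only: cone)
  then show ?thesis
    by (auto simp: indicator_def)
qed

text \<open>Induction on the number of generators: decompose the base with respect to
  \<open>w t\<close>, recurse in each piece with its index \<open>i\<close> as the new last
  generator, then append \<open>w t\<close>. A list records the cones so that repetitions are
  counted.\<close>

lemma chain_decomposition:
  fixes w :: "'i::linorder \<Rightarrow> 'a::euclidean_space"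
  assumes "finite I" "t \<in> I" "indep_family I w"
  shows "\<exists>xs \<S>. length xs \<le> fact (card I - 1) \<and>
    finite \<S> \<and> (\<forall>S\<in>\<S>. subspace S \<and> dim S < card I) \<and>
    (\<forall>(s, v)\<in>set xs. s \<in> {-1, 1} \<and> is_chain_of I t w v) \<and>
    (\<forall>x\<in>span (w ` I) - \<Union>\<S>. indicat_real (cone_on I w) x =
      (\<Sum>(s, v)\<leftarrow>xs. s * indicat_real (cone_on {1..card I} v) x))"
  using assms
proof (induction "card I" arbitrary: I t w)
  case 0
  then show ?case by auto
next
  case (Suc k)
  define J where "J = I - {t}"
  have J: "finite J" "t \<notin> J" "I = insert t J" "card J = k" "card I = Suc k"
    using Suc.hyps(2) Suc.prems by (auto simp: J_def)
  have indJ: "indep_family J w" and wt: "w t \<notin> span (w ` J)"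
    using Suc.prems(3) indep_family_insert_iff[OF J(1,2)] J(3) by blast+
  have wt0: "w t \<noteq> 0"
    using wt span_zero by metis
  show ?case
  proof (cases "J = {}")
    case True
    let ?v = "\<lambda>_ :: nat. w t /\<^sub>R norm (w t)"
    have I: "I = {t}" "k = 0"
      using True J by auto
    have "is_chain_of I t w ?v"
      using wt0 by (simp add: is_chain_of_def I chain_family_def indep_family_def)
    moreover have "indicat_real (cone_on {t} w) x = indicat_real (cone_on {1..1::nat} ?v) x" if "x \<in> span {w t}" for x
    proof -
      obtain r where "x = 0 + r *\<^sub>R w t"
        using \<open>x \<in> span {w t}\<close> by (auto simp: span_singleton)
      then show ?thesis
        using indicator_cone_on_extend[of "w t" "\<lambda>_. w t /\<^sub>R norm (w t)" 0 0 "norm (w t)" r]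
          cone_on_insert_iff[of "{}" t w 0 r] wt0
        by (simp add: cone_on_def indicator_def fun_upd_def)
    qed
    ultimately show ?thesis
      using I by (intro exI[of _ "[(1, ?v)]"] exI[of _ "{}"]) auto
  next
    case False
    obtain L s u \<H> where L: "L \<subseteq> J"
      and u': "\<forall>i\<in>L. s i \<in> {-1, 1 :: real} \<and> indep_family J (u i) \<and>
        span (u i ` J) = span (w ` J) \<and> (\<forall>j\<in>J - {i}. u i j \<bullet> w t = 0)"
      and \<H>': "finite \<H>" "\<forall>S\<in>\<H>. dim S < card J"
        "\<forall>h\<in>span (w ` J) - \<Union>\<H>. indicat_real (cone_on J w) h =
          (\<Sum>i\<in>L. s i * indicat_real (cone_on J (u i)) h)"
      using cone_on_decomposition_step[OF J(1) False indJ, of "w t"] by (elim exE conjE) (rule that)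
    have u: "\<And>i. i \<in> L \<Longrightarrow> s i \<in> {-1, 1}" "\<And>i. i \<in> L \<Longrightarrow> indep_family J (u i)"
        "\<And>i. i \<in> L \<Longrightarrow> span (u i ` J) = span (w ` J)" "\<And>i. i \<in> L \<Longrightarrow> \<forall>j\<in>J - {i}. u i j \<bullet> w t = 0"
      using u' by blast+
    have \<H>: "finite \<H>" "\<And>S. S \<in> \<H> \<Longrightarrow> dim S < card J"
        "\<And>h. h \<in> span (w ` J) - \<Union>\<H> \<Longrightarrow> indicat_real (cone_on J w) h =
          (\<Sum>i\<in>L. s i * indicat_real (cone_on J (u i)) h)"
      using \<H>' by blast+
    have "finite L"
      using L J(1) finite_subset by blast
    \<comment> \<open>Packaging the induction hypothesis as a predicate allows lists and exceptional
      subspaces to be chosen for all \<open>i\<close> in \<open>L\<close> at once.\<close>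
    define good where "good = (\<lambda>i xs \<S>. length xs \<le> fact (k - 1) \<and>
        finite \<S> \<and> (\<forall>S\<in>\<S>. subspace S \<and> dim S < k) \<and>
        (\<forall>(r, v)\<in>set xs. r \<in> {-1, 1} \<and> is_chain_of J i (u i) v) \<and>
        (\<forall>x\<in>span (w ` J) - \<Union>\<S>. indicat_real (cone_on J (u i)) x =
          (\<Sum>(r, v)\<leftarrow>xs. r * indicat_real (cone_on {1..k} v) x)))"
    have "\<exists>xs \<S>. good i xs \<S>" if i: "i \<in> L" for i
    proof -
      have "i \<in> J" using L i by blast
      from Suc.hyps(1)[OF J(4)[symmetric] J(1) this u(2)[OF i]] show ?thesis
        unfolding good_def J(4) u(3)[OF i] .
    qed
    then obtain X where "\<And>i. i \<in> L \<Longrightarrow> \<exists>\<S>. good i (X i) \<S>"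
      by metis
    then obtain \<S> where good: "\<And>i. i \<in> L \<Longrightarrow> good i (X i) (\<S> i)"
      by metis
    have X: "\<And>i. i \<in> L \<Longrightarrow> length (X i) \<le> fact (k - 1)"
        "\<And>i. i \<in> L \<Longrightarrow> finite (\<S> i)" "\<And>i S. i \<in> L \<Longrightarrow> S \<in> \<S> i \<Longrightarrow> dim S < k"
        "\<And>i r v. i \<in> L \<Longrightarrow> (r, v) \<in> set (X i) \<Longrightarrow> r \<in> {-1, 1} \<and> is_chain_of J i (u i) v"
        "\<And>i x. i \<in> L \<Longrightarrow> x \<in> span (w ` J) - \<Union>(\<S> i) \<Longrightarrow> indicat_real (cone_on J (u i)) x =
          (\<Sum>(r, v)\<leftarrow>X i. r * indicat_real (cone_on {1..k} v) x)"
      using good unfolding good_def by blast+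
    define ext where "ext = (\<lambda>v :: nat \<Rightarrow> 'a. v(Suc k := w t /\<^sub>R norm (w t)))"
    define Y where "Y = (\<lambda>i. map (\<lambda>(r, v). (s i * r, ext v)) (X i))"
    define xs where "xs = concat (map Y (sorted_list_of_set L))"
    \<comment> \<open>If \<open>h + r *\<^sub>R w t\<close> avoids
      \<open>span (insert (w t) S)\<close>, then \<open>h\<close> avoids \<open>S\<close>, and the
      dimension grows by at most one. Taking spans also yields subspaces from the members of
      \<open>\<H>\<close>.\<close>
    define \<T> where "\<T> = (\<lambda>S. span (insert (w t) S)) ` (\<H> \<union> (\<Union>i\<in>L. \<S> i))"
    have chain: "is_chain_of I t w (ext v)" "span (v ` {1..k}) = span (w ` J)"
      if i: "i \<in> L" and v: "(r, v) \<in> set (X i)" for i r v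
    proof -
      have iJ: "i \<in> J" using L i by blast
      have "u i i \<noteq> 0"
      proof
        assume "u i i = 0"
        then have "(\<Sum>j\<in>J. of_bool (j = i) *\<^sub>R u i j) = 0"
          by (intro sum.neutral) auto
        then show False
          using indep_familyD[OF u(2)[OF i] _ iJ, of "\<lambda>j. of_bool (j = i)"] by simp
      qed
      note * = is_chain_of_extend[OF J(1,2) iJ wt u(3)[OF i] u(4)[OF i] this, of v]
      show "is_chain_of I t w (ext v)" "span (v ` {1..k}) = span (w ` J)"
        using * X(4)[OF i v] unfolding J(4) J(3)[symmetric] ext_def by blast+
    qed
    have "length xs = (\<Sum>i\<in>L. length (X i))"
      using \<open>finite L\<close>
      by (simp add: xs_def Y_def length_concat o_def sum_list_distinct_conv_sum_set)
    also have "\<dots> \<le> card L * fact (k - 1)"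
      using X(1) sum_bounded_above[of L "\<lambda>i. length (X i)" "fact (k - 1)"] by simp
    also have "\<dots> \<le> k * fact (k - 1)"
      using card_mono[OF J(1) L] J(4) by simp
    \<comment> \<open>Since \<open>J\<close> is nonempty, \<open>k\<close> is positive and the
      truncated subtraction \<open>k - 1\<close> is genuine.\<close>
    also have "\<dots> = fact k"
      using False J(1,4) by (cases k) auto
    finally have "length xs \<le> fact (card I - 1)"
      using J(5) by simp
    moreover have "finite \<T>"
      using \<open>finite L\<close> \<H>(1) X(2) by (simp add: \<T>_def)
    moreover have "\<forall>S\<in>\<T>. subspace S \<and> dim S < card I"
    proof
      fix S assume "S \<in> \<T>"
      then obtain S' where S': "S = span (insert (w t) S')" "S' \<in> \<H> \<union> (\<Union>i\<in>L. \<S> i)"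
        by (auto simp: \<T>_def)
      then have "dim S' < k"
        using \<H>(2) X(3) J(4) by auto
      then show "subspace S \<and> dim S < card I"
        unfolding S'(1) J(5) by (simp add: dim_insert)
    qed
    moreover have "\<forall>(r, v)\<in>set xs. r \<in> {-1, 1} \<and> is_chain_of I t w v"
    proof -
      have "r \<in> {-1, 1} \<and> is_chain_of I t w v" if "(r, v) \<in> set xs" for r v
      proof -
        obtain i r' v' where i: "i \<in> L" "(r', v') \<in> set (X i)" "r = s i * r'" "v = ext v'"
          using \<open>(r, v) \<in> set xs\<close> \<open>finite L\<close> by (auto simp: xs_def Y_def)
        then show ?thesis
          using chain(1)[OF i(1,2)] u(1)[OF i(1)] X(4)[OF i(1,2)] by auto
      qed
      then show ?thesis by blast
    qed
    moreover have "\<forall>x\<in>span (w ` I) - \<Union>\<T>. indicat_real (cone_on I w) x =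
      (\<Sum>(r, v)\<leftarrow>xs. r * indicat_real (cone_on {1..card I} v) x)"
    proof
      fix x assume x: "x \<in> span (w ` I) - \<Union>\<T>"
      then obtain r where r: "x - r *\<^sub>R w t \<in> span (w ` J)"
        unfolding J(3) by (auto simp: span_insert)
      define h where "h = x - r *\<^sub>R w t"
      have h: "h \<in> span (w ` J)" "x = h + r *\<^sub>R w t"
        using r by (auto simp: h_def)
      have notin: "h \<notin> S" if "S \<in> \<H> \<union> (\<Union>i\<in>L. \<S> i)" for S
      proof
        assume "h \<in> S"
        then have "x \<in> span (insert (w t) S)"
          unfolding h(2) by (intro span_add span_scale span_base) auto
        then show False
          using x that by (auto simp: \<T>_def)
      qed
      \<comment> \<open>Split off \<open>w t\<close>, apply the decomposition of the base and then
        the recursive decompositions to \<open>h\<close>, and attach \<open>w t\<close> to every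
        resulting chain.\<close>
      have "indicat_real (cone_on I w) x = of_bool (0 \<le> r) * indicat_real (cone_on J w) h"
        unfolding J(3) h(2) using cone_on_insert_iff[OF J(1,2) wt h(1), of r] by (auto simp: indicator_def)
      also have "indicat_real (cone_on J w) h = (\<Sum>i\<in>L. s i * indicat_real (cone_on J (u i)) h)"
        using h(1) notin by (intro \<H>(3)) blast
      also have "\<dots> = (\<Sum>i\<in>L. s i * (\<Sum>(r, v)\<leftarrow>X i. r * indicat_real (cone_on {1..k} v) h))"
        by (intro sum.cong refl arg_cong2[where f = "(*)"] X(5)) (use h(1) notin in blast)+
      also have "of_bool (0 \<le> r) * \<dots> =
          (\<Sum>i\<in>L. \<Sum>(q, v)\<leftarrow>Y i. q * indicat_real (cone_on {1..card I} v) x)"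
        unfolding sum_distrib_left
      proof (rule sum.cong[OF refl])
        fix i assume i: "i \<in> L"
        have "(\<Sum>(q, v)\<leftarrow>Y i. q * indicat_real (cone_on {1..card I} v) x) =
            (\<Sum>(q, v)\<leftarrow>X i. s i * q * indicat_real (cone_on {1..card I} (ext v)) x)"
          by (simp add: Y_def o_def case_prod_unfold)
        also have "\<dots> = (\<Sum>(q, v)\<leftarrow>X i. of_bool (0 \<le> r) * s i * (q * indicat_real (cone_on {1..k} v) h))"
        proof (intro arg_cong[where f = sum_list] map_cong refl, clarify)
          fix q v assume v: "(q, v) \<in> set (X i)"
          have "indicat_real (cone_on {1..card I} (ext v)) x = of_bool (0 \<le> r) * indicat_real (cone_on {1..k} v) h"
            unfolding ext_def J(5) h(2) using wt wt0 h(1) chain(2)[OF i v]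
            by (intro indicator_cone_on_extend) auto
          then show "s i * q * indicat_real (cone_on {1..card I} (ext v)) x =
            of_bool (0 \<le> r) * s i * (q * indicat_real (cone_on {1..k} v) h)"
            by simp
        qed
        also have "\<dots> = of_bool (0 \<le> r) * s i * (\<Sum>(q, v)\<leftarrow>X i. q * indicat_real (cone_on {1..k} v) h)"
          by (simp only: sum_list_const_mult case_prod_unfold)
        finally show "of_bool (0 \<le> r) * (s i * (\<Sum>(q, v)\<leftarrow>X i. q * indicat_real (cone_on {1..k} v) h)) =
          (\<Sum>(q, v)\<leftarrow>Y i. q * indicat_real (cone_on {1..card I} v) x)"
          by (simp only: mult.assoc)
      qed
      also have "\<dots> = (\<Sum>(q, v)\<leftarrow>xs. q * indicat_real (cone_on {1..card I} v) x)"
        using \<open>finite L\<close>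
        by (simp add: xs_def map_concat sum_list_concat_map o_def sum_list_distinct_conv_sum_set)
      finally show "indicat_real (cone_on I w) x = (\<Sum>(q, v)\<leftarrow>xs. q * indicat_real (cone_on {1..card I} v) x)" .
    qed
    ultimately show ?thesis
      by blast
  qed
qed

subsection \<open>Linear substitution in the Lebesgue integral\<close>

text \<open>The shear moves a point only in direction \<open>e\<close>, by an amount independent of
  its \<open>e\<close> coordinate since \<open>v \<bullet> e = 0\<close>. With that coordinate
  innermost in Fubini, translation invariance on the line suffices.\<close>

lemma nn_integral_lborel_shear:
  fixes v e :: "'a::euclidean_space" and f :: "'a \<Rightarrow> ennreal"
  assumes [measurable]: "f \<in> borel_measurable borel" and e: "e \<in> Basis" and v: "v \<bullet> e = 0"
  shows "(\<integral>\<^sup>+x. f x \<partial>lborel) = (\<integral>\<^sup>+x. f (x + (x \<bullet> v) *\<^sub>R e) \<partial>lborel)"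
proof -
  interpret product_sigma_finite "\<lambda>_::'a. lborel :: real measure" ..
  define B where "B = Basis - {e}"
  have B: "finite B" "e \<notin> B" "Basis = insert e B"
    using e by (auto simp: B_def)
  let ?h = "\<lambda>g::'a \<Rightarrow> real. \<Sum>b\<in>Basis. g b *\<^sub>R b"
  define r where "r = (\<lambda>g::'a \<Rightarrow> real. \<Sum>b\<in>B. g b *\<^sub>R b)"
  have h: "?h (g(e := y)) = y *\<^sub>R e + r g" for g y
  proof -
    have "(\<Sum>b\<in>B. (g(e := y)) b *\<^sub>R b) = r g"
      unfolding r_def using B(2) by (intro sum.cong) auto
    then show ?thesis
      unfolding B(3) using B(1,2) by simp
  qed
  have hv: "?h (g(e := y)) \<bullet> v = r g \<bullet> v" for g y
    unfolding h using v by (simp add: inner_simps inner_commute)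
  have eq: "(\<integral>\<^sup>+x. k x \<partial>lborel) = (\<integral>\<^sup>+g. (\<integral>\<^sup>+y. k (?h (g(e := y))) \<partial>lborel) \<partial>Pi\<^sub>M B (\<lambda>_. lborel))"
    if [measurable]: "k \<in> borel_measurable borel" for k :: "'a \<Rightarrow> ennreal"
  proof -
    have "(\<integral>\<^sup>+x. k x \<partial>lborel) = (\<integral>\<^sup>+g. k (?h g) \<partial>Pi\<^sub>M Basis (\<lambda>_. lborel))"
      by (subst lborel_def, subst nn_integral_distr) (simp_all flip: lborel_eq_real)
    also have "\<dots> = (\<integral>\<^sup>+g. k (?h g) \<partial>Pi\<^sub>M (insert e B) (\<lambda>_. lborel))"
      using B(3) by simp
    also have "\<dots> = (\<integral>\<^sup>+g. (\<integral>\<^sup>+y. k (?h (g(e := y))) \<partial>lborel) \<partial>Pi\<^sub>M B (\<lambda>_. lborel))"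
    proof (rule product_nn_integral_insert)
      have "(\<lambda>g. k (?h g)) \<in> borel_measurable (Pi\<^sub>M Basis (\<lambda>_. lborel))"
        by measurable
      then show "(\<lambda>g. k (?h g)) \<in> borel_measurable (Pi\<^sub>M (insert e B) (\<lambda>_. lborel))"
        using B(3) by simp
    qed (use B in auto)
    finally show ?thesis .
  qed
  have "(\<integral>\<^sup>+y. f (?h (g(e := y))) \<partial>lborel) =
        (\<integral>\<^sup>+y. f (?h (g(e := y)) + (?h (g(e := y)) \<bullet> v) *\<^sub>R e) \<partial>lborel)" for g
  proof -
    have m: "(\<lambda>y. f (y *\<^sub>R e + r g)) \<in> borel_measurable borel"
      by measurable
    have "(\<integral>\<^sup>+y. f (y *\<^sub>R e + r g) \<partial>lborel) =
          (\<integral>\<^sup>+y. f ((r g \<bullet> v + 1 * y) *\<^sub>R e + r g) \<partial>lborel)"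
      using nn_integral_real_affine[OF m, of 1 "r g \<bullet> v"] by simp
    also have "\<dots> = (\<integral>\<^sup>+y. f (?h (g(e := y)) + (?h (g(e := y)) \<bullet> v) *\<^sub>R e) \<partial>lborel)"
      unfolding hv unfolding h by (simp only: mult_1 scaleR_add_left add_ac)
    finally show ?thesis
      unfolding h .
  qed
  then have "(\<integral>\<^sup>+g. (\<integral>\<^sup>+y. f (?h (g(e := y))) \<partial>lborel) \<partial>Pi\<^sub>M B (\<lambda>_. lborel)) =
    (\<integral>\<^sup>+g. (\<integral>\<^sup>+y. f (?h (g(e := y)) + (?h (g(e := y)) \<bullet> v) *\<^sub>R e) \<partial>lborel) \<partial>Pi\<^sub>M B (\<lambda>_. lborel))"
    by (simp only:)
  moreover have "(\<lambda>x. f (x + (x \<bullet> v) *\<^sub>R e)) \<in> borel_measurable borel"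
    by measurable
  ultimately show ?thesis
    using eq[of f] eq[of "\<lambda>x. f (x + (x \<bullet> v) *\<^sub>R e)"] assms(1) by (simp only:)
qed

text \<open>The preimage of a box is a box with permuted side lengths, and boxes determine Lebesgue
  measure.\<close>

lemma nn_integral_lborel_swap:
  fixes f :: "real^'n \<Rightarrow> ennreal"
  assumes [measurable]: "f \<in> borel_measurable borel"
  shows "(\<integral>\<^sup>+x. f x \<partial>lborel) = (\<integral>\<^sup>+x. f (\<chi> i. x $ Transposition.transpose m n i) \<partial>lborel)"
proof -
  let ?T = "\<lambda>x :: real^'n. \<chi> i. x $ Transposition.transpose m n i"
  have T: "?T \<in> borel_measurable borel"
    by (intro borel_measurable_continuous_onI) (simp add: continuous_on_vec_lambda continuous_on_component continuous_on_id)
  have "lborel = distr lborel borel ?T"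
  proof (rule lborel_eqI)
    fix l u :: "real^'n"
    assume le: "\<And>b. b \<in> Basis \<Longrightarrow> l \<bullet> b \<le> u \<bullet> b"
    have le': "l $ i \<le> u $ i" for i
      using le[of "axis i 1"] by (simp add: axis_in_Basis_iff inner_axis)
    have vim: "?T -` box l u = box (?T l) (?T u)"
    proof (intro set_eqI)
      fix x
      have "(\<forall>i. l $ i < x $ Transposition.transpose m n i \<and> x $ Transposition.transpose m n i < u $ i) \<longleftrightarrow>
        (\<forall>i. l $ Transposition.transpose m n i < x $ i \<and> x $ i < u $ Transposition.transpose m n i)"
        by (metis transpose_involutory)
      then show "x \<in> ?T -` box l u \<longleftrightarrow> x \<in> box (?T l) (?T u)"
        by (simp add: mem_box_cart)
    qed
    have basis: "(\<Prod>b\<in>Basis. g \<bullet> b) = (\<Prod>i\<in>UNIV. g $ i)" for g :: "real^'n"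
      by (simp add: Basis_vec_def UNION_singleton_eq_range prod.reindex inj_on_def axis_eq_axis inner_axis)
    have perm: "(\<Prod>i\<in>UNIV. h (Transposition.transpose m n i)) = (\<Prod>i\<in>UNIV. h i)" for h :: "'n \<Rightarrow> real"
      by (rule prod.reindex_bij_betw) simp
    have le2: "\<And>b. b \<in> Basis \<Longrightarrow> ?T l \<bullet> b \<le> ?T u \<bullet> b"
      using le' by (auto simp: Basis_vec_def inner_axis)
    have "emeasure (distr lborel borel ?T) (box l u) = emeasure lborel (box (?T l) (?T u))"
      using T by (simp add: emeasure_distr vim)
    also have "\<dots> = ennreal (\<Prod>b\<in>Basis. (?T u - ?T l) \<bullet> b)"
      using le2 by (rule emeasure_lborel_box)
    also have "(\<Prod>b\<in>Basis. (?T u - ?T l) \<bullet> b) = (\<Prod>b\<in>Basis. (u - l) \<bullet> b)"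
      unfolding basis using perm[of "\<lambda>i. (u - l) $ i"] by simp
    finally show "emeasure (distr lborel borel ?T) (box l u) = (\<Prod>b\<in>Basis. (u - l) \<bullet> b)" .
  qed simp
  then have "(\<integral>\<^sup>+x. f x \<partial>lborel) = (\<integral>\<^sup>+x. f x \<partial>distr lborel borel ?T)"
    by simp
  also have "\<dots> = (\<integral>\<^sup>+x. f (?T x) \<partial>lborel)"
    using T by (intro nn_integral_distr) simp_all
  finally show ?thesis .
qed

text \<open>Factorization into elementary matrices: the formula is multiplicative in
  \<open>A\<close> and is verified for each kind of factor.\<close>

lemma nn_integral_lborel_matrix:
  fixes A :: "real^'n^'n" and f :: "real^'n \<Rightarrow> ennreal"
  assumes "f \<in> borel_measurable borel" "det A \<noteq> 0"
  shows "(\<integral>\<^sup>+x. f x \<partial>lborel) = ennreal \<bar>det A\<bar> * (\<integral>\<^sup>+x. f (A *v x) \<partial>lborel)"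
proof -
  have mult: "(\<lambda>x. A *v x) \<in> borel_measurable borel" for A :: "real^'n^'n"
    by (intro borel_measurable_continuous_onI linear_continuous_on matrix_vector_mul_bounded_linear)
  have meas: "(\<lambda>x. f (A *v x)) \<in> borel_measurable borel"
    if "f \<in> borel_measurable borel" for A :: "real^'n^'n" and f :: "real^'n \<Rightarrow> ennreal"
    by (rule measurable_compose[OF mult that])
  \<comment> \<open>The integrand is quantified inside the induction because a product
    \<open>A ** B\<close> requires the hypothesis for \<open>B\<close> at the composite
    \<open>\<lambda>x. f (A *v x)\<close>.\<close>
  have "\<forall>f. f \<in> borel_measurable borel \<longrightarrow> det A \<noteq> 0 \<longrightarrow>
     (\<integral>\<^sup>+x. f x \<partial>lborel) = ennreal \<bar>det A\<bar> * (\<integral>\<^sup>+x. f (A *v x) \<partial>lborel)"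
  proof (induction A rule: induct_matrix_elementary)
    case (1 A B)
    show ?case
    proof (intro allI impI)
      fix f :: "real^'n \<Rightarrow> ennreal"
      assume f: "f \<in> borel_measurable borel" and "det (A ** B) \<noteq> 0"
      then have "det A \<noteq> 0" "det B \<noteq> 0"
        by (auto simp: det_mul)
      then have "(\<integral>\<^sup>+x. f x \<partial>lborel) = ennreal \<bar>det A\<bar> * (\<integral>\<^sup>+x. f (A *v x) \<partial>lborel)"
        using 1 f by blast
      also have "(\<integral>\<^sup>+x. f (A *v x) \<partial>lborel) = ennreal \<bar>det B\<bar> * (\<integral>\<^sup>+x. f (A *v (B *v x)) \<partial>lborel)"
        using 1 meas[OF f, of A] \<open>det B \<noteq> 0\<close> by blast
      finally show "(\<integral>\<^sup>+x. f x \<partial>lborel) = ennreal \<bar>det (A ** B)\<bar> * (\<integral>\<^sup>+x. f ((A ** B) *v x) \<partial>lborel)"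
        by (simp add: det_mul abs_mult ennreal_mult mult.assoc matrix_vector_mul_assoc)
    qed
  next
    \<comment> \<open>A zero row forces \<open>det A = 0\<close>, so this case is vacuous.\<close>
    case (2 A i)
    then show ?case
      by (simp add: det_zero_row)
  next
    case (3 A)
    show ?case
    proof (intro allI impI)
      fix f :: "real^'n \<Rightarrow> ennreal"
      assume f[measurable]: "f \<in> borel_measurable borel" and "det A \<noteq> 0"
      have d: "det A = (\<Prod>i\<in>UNIV. A $ i $ i)"
        using 3 by (rule det_diagonal)
      \<comment> \<open>The scaling formula for \<open>lborel\<close> takes its factors at basis
        vectors, so the diagonal is rewritten as a function of these: its value at
        \<open>axis i 1\<close> is the \<open>i\<close>-th diagonal entry.\<close>
      define c where "c = (\<lambda>b :: real^'n. \<Sum>i\<in>UNIV. b $ i * A $ i $ i)"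
      have c: "c (axis i 1) = A $ i $ i" for i
      proof -
        have "c (axis i 1) = (\<Sum>j\<in>UNIV. if j = i then A $ j $ j else 0)"
          unfolding c_def by (rule sum.cong) (auto simp: axis_def)
        then show ?thesis
          by simp
      qed
      have cn: "c j \<noteq> 0" if "j \<in> Basis" for j
        using that \<open>det A \<noteq> 0\<close> c by (auto simp: Basis_vec_def d)
      have pc: "(\<Prod>j\<in>Basis. \<bar>c j\<bar>) = \<bar>det A\<bar>"
        unfolding d abs_prod
        by (simp add: Basis_vec_def UNION_singleton_eq_range prod.reindex inj_on_def axis_eq_axis c)
      have T: "(0 + (\<Sum>j\<in>Basis. (c j * (x \<bullet> j)) *\<^sub>R j)) = A *v x" for x
      proof -
        have "(0 + (\<Sum>j\<in>Basis. (c j * (x \<bullet> j)) *\<^sub>R j)) = (\<Sum>i\<in>UNIV. (A $ i $ i * x $ i) *\<^sub>R axis i 1)"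
          by (simp add: Basis_vec_def UNION_singleton_eq_range sum.reindex inj_on_def axis_eq_axis c inner_axis)
        also have "\<dots> = A *v x"
        proof (rule vec_eq_iff[THEN iffD2], rule allI)
          fix k
          have "(\<Sum>i\<in>UNIV. (A $ i $ i * x $ i) *\<^sub>R axis i 1) $ k = (\<Sum>i\<in>UNIV. if i = k then A $ k $ i * x $ i else 0)"
            unfolding sum_component by (rule sum.cong) (auto simp: axis_def)
          also have "\<dots> = (\<Sum>i\<in>UNIV. A $ k $ i * x $ i)"
            by (rule sum.cong) (auto simp: 3)
          finally show "(\<Sum>i\<in>UNIV. (A $ i $ i * x $ i) *\<^sub>R axis i 1) $ k = (A *v x) $ k"
            by (simp add: matrix_vector_mult_def)
        qed
        finally show ?thesis .
      qed
      have "(\<integral>\<^sup>+x. f x \<partial>lborel) =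
        (\<integral>\<^sup>+x. f x \<partial>density (distr lborel borel (\<lambda>x. 0 + (\<Sum>j\<in>Basis. (c j * (x \<bullet> j)) *\<^sub>R j))) (\<lambda>_. (\<Prod>j\<in>Basis. \<bar>c j\<bar>)))"
        using lborel_affine_euclidean[of c 0] cn by simp
      also have "\<dots> = ennreal \<bar>det A\<bar> * (\<integral>\<^sup>+x. f (A *v x) \<partial>lborel)"
        unfolding T pc using meas[OF f, of A] f mult[of A]
        by (subst nn_integral_density; simp; subst nn_integral_distr; simp add: nn_integral_cmult)
      finally show "(\<integral>\<^sup>+x. f x \<partial>lborel) = ennreal \<bar>det A\<bar> * (\<integral>\<^sup>+x. f (A *v x) \<partial>lborel)" .
    qed
  next
    case (4 m n)
    let ?S = "(\<chi> i j. mat 1 $ i $ Transposition.transpose m n j) :: real^'n^'n"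
    have "?S *v x = (\<chi> i. x $ Transposition.transpose m n i)" for x :: "real^'n"
    proof (rule vec_eq_iff[THEN iffD2], rule allI)
      fix k
      have "(?S *v x) $ k = (\<Sum>j\<in>UNIV. if j = Transposition.transpose m n k then x $ j else 0)"
        unfolding matrix_vector_mult_def vec_lambda_beta by (rule sum.cong) (auto simp: mat_def)
      then show "(?S *v x) $ k = (\<chi> i. x $ Transposition.transpose m n i) $ k"
        by simp
    qed
    moreover have "\<bar>det ?S\<bar> = 1"
      using det_permute_columns[of "Transposition.transpose m n" "mat 1 :: real^'n^'n"]
      by (simp add: permutes_swap_id sign_swap_id)
    ultimately show ?case
      using nn_integral_lborel_swap[of _ m n] by simp
  next
    case (5 m n c)
    let ?S = "(\<chi> i j. if i = m \<and> j = n then c else of_bool (i = j)) :: real^'n^'n"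
    have S: "?S *v x = x + (x \<bullet> (c *\<^sub>R axis n 1)) *\<^sub>R axis m 1" for x :: "real^'n"
    proof (rule vec_eq_iff[THEN iffD2], rule allI)
      fix k
      have "(?S *v x) $ k = (\<Sum>j\<in>UNIV. (if j = k then x $ j else 0) + (if j = n then (if k = m then c * x $ j else 0) else 0))"
        unfolding matrix_vector_mult_def vec_lambda_beta using 5 by (intro sum.cong) auto
      also have "\<dots> = x $ k + (if k = m then c * x $ n else 0)"
        by (simp add: sum.distrib)
      finally show "(?S *v x) $ k = (x + (x \<bullet> (c *\<^sub>R axis n 1)) *\<^sub>R axis m 1) $ k"
        by (simp add: inner_axis) (simp add: axis_def)
    qed
    \<comment> \<open>The matrix arises from the identity by a row operation, whence determinant
      one.\<close>
    have "?S = (\<chi> k. if k = m then row m (mat 1) + c *s row n (mat 1) else row k (mat 1))"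
      using 5 by (auto simp: vec_eq_iff row_def mat_def)
    then have d: "det ?S = 1"
      using det_row_operation[OF 5, of "mat 1 :: real^'n^'n" c] by simp
    have b: "axis m 1 \<in> (Basis :: (real^'n) set)" "(c *\<^sub>R axis n 1) \<bullet> (axis m 1 :: real^'n) = 0"
      using 5 by (simp_all add: axis_in_Basis_iff inner_axis_axis)
    show ?case
      unfolding S d using nn_integral_lborel_shear[OF _ b]
      by (simp only: abs_one ennreal_1 mult_1) blast
  qed
  then show ?thesis
    using assms by blast
qed

subsection \<open>The Gaussian integral of a tridiagonal form over the orthant\<close>

lemma nn_integral_lborel_prod_cart:
  fixes f :: "'n::finite \<Rightarrow> real \<Rightarrow> ennreal"
  assumes "\<And>i. f i \<in> borel_measurable borel"
  shows "(\<integral>\<^sup>+x. (\<Prod>i\<in>UNIV. f i (x $ i)) \<partial>(lborel :: (real^'n) measure)) = (\<Prod>i\<in>UNIV. \<integral>\<^sup>+t. f i t \<partial>lborel)"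
proof -
  have basis: "(\<Prod>b\<in>Basis. h b) = (\<Prod>i\<in>UNIV. h (axis i 1))" for h :: "real^'n \<Rightarrow> ennreal"
    by (simp add: Basis_vec_def UNION_singleton_eq_range prod.reindex inj_on_def axis_eq_axis)
  have "(\<integral>\<^sup>+x. (\<Prod>b\<in>Basis. f (axis_index b) (x \<bullet> b)) \<partial>(lborel :: (real^'n) measure)) =
        (\<Prod>b\<in>(Basis::(real^'n) set). \<integral>\<^sup>+t. f (axis_index b) t \<partial>lborel)"
    using assms by (intro nn_integral_lborel_prod) auto
  then show ?thesis
    by (simp add: basis inner_axis)
qed

text \<open>The half-integer values, in the form in which the even Gaussian moments are
  stated.\<close>

lemma Gamma_nat_plus_half: "Gamma (real k + 1 / 2) = sqrt pi * fact (2 * k) / (2 ^ (2 * k) * fact k)"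
proof (induction k)
  case (Suc k)
  have "Gamma (real (Suc k) + 1 / 2) = (real k + 1 / 2) * Gamma (real k + 1 / 2)"
    using Gamma_plus1[of "real k + 1 / 2"] nonpos_Ints_nonpos[of "real k + 1 / 2"]
    by (simp add: add_ac) force
  also have "\<dots> = sqrt pi * fact (2 * Suc k) / (2 ^ (2 * Suc k) * fact (Suc k))"
  proof -
    have f: "fact (2 * Suc k) = 4 * (real k + 1) * (real k + 1 / 2) * fact (2 * k)"
      by (simp add: algebra_simps)
    have p: "2 ^ (2 * Suc k) * fact (Suc k) = 4 * (real k + 1) * (2 ^ (2 * k) * fact k)"
      by simp
    have cancel: "a * (s * F / P) = s * (4 * K * a * F) / (4 * K * P)" if "K \<noteq> 0" for a s F P K :: real
      using that by simp
    show ?thesis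
      unfolding Suc.IH f p by (rule cancel) simp
  qed
  finally show ?case .
qed (simp add: Gamma_one_half_real)

text \<open>The argument \<open>(1 + real k) / 2\<close> is a half-integer for even \<open>k\<close>
  and an integer for odd \<open>k\<close>, matching the two kinds of Gaussian moments on the
  half-line.\<close>

lemma nn_integral_power_gaussian:
  "(\<integral>\<^sup>+t. ennreal (indicator {0..} t * (t ^ k * exp (- t\<^sup>2))) \<partial>lborel) = ennreal (Gamma ((1 + real k) / 2) / 2)"
proof -
  have *: "(\<integral>\<^sup>+t. ennreal (indicator {0..} t * (t ^ k * exp (- t\<^sup>2))) \<partial>lborel) = ennreal c"
    if "has_bochner_integral lborel (\<lambda>x::real. indicator {0..} x *\<^sub>R (exp (- x\<^sup>2) * x ^ k)) c" for c
    using that by (subst nn_integral_eq_integral)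
      (auto simp: has_bochner_integral_iff mult_ac indicator_def intro!: AE_I2)
  show ?thesis
  proof (cases "even k")
    case True
    then obtain j where j: "k = 2 * j" by blast
    have "(1 + real k) / 2 = real j + 1 / 2"
      by (simp add: j field_simps)
    then have "Gamma ((1 + real k) / 2) = sqrt pi * fact (2 * j) / (2 ^ (2 * j) * fact j)"
      by (simp only: Gamma_nat_plus_half)
    then show ?thesis
      using *[unfolded j, OF gaussian_moment_even_pos] by (simp add: j)
  next
    case False
    then obtain j where j: "k = 2 * j + 1" using oddE by blast
    have "(1 + real k) / 2 = 1 + real j"
      by (simp add: j field_simps)
    then have "Gamma ((1 + real k) / 2) = fact j"
      by (simp only: Gamma_fact)
    then show ?thesis
      using *[unfolded j, OF gaussian_moment_odd_pos] by (simp add: j)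
  qed
qed

text \<open>Outside the index set \<open>PiE\<close> fixes the value \<open>undefined\<close>,
  multi-exponents the value \<open>0\<close>. The bijection gives access to the product formulas for
  sums over \<open>PiE\<close>.\<close>

lemma bij_betw_multi_exponents:
  "bij_betw (\<lambda>b i. if i \<in> {1..<n} then b i else 0) (PiE {1..<n} (\<lambda>_. UNIV)) (multi_exponents n)"
  by (rule bij_betwI[where g = "\<lambda>b. restrict b {1..<n}"])
     (auto simp: multi_exponents_def fun_eq_iff PiE_def extensional_def)

lemma countable_multi_exponents: "countable (multi_exponents n)"
proof -
  have "countable (PiE {1..<n} (\<lambda>_. UNIV :: nat set))"
    by (intro countable_PiE) auto
  then show ?thesis
    by (subst bij_betw_imp_surj_on[OF bij_betw_multi_exponents, symmetric]) (rule countable_image)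
qed

text \<open>The sum over multi-exponents is a product of one-variable exponential series.\<close>

lemma
  fixes t :: "nat \<Rightarrow> real"
  shows abs_summable_exp_multi: "(\<lambda>b. \<Prod>i\<in>{1..<n}. t i ^ b i / fact (b i)) abs_summable_on multi_exponents n"
    and infsetsum_exp_multi:
      "infsetsum (\<lambda>b. \<Prod>i\<in>{1..<n}. t i ^ b i / fact (b i)) (multi_exponents n) = exp (\<Sum>i\<in>{1..<n}. t i)"
proof -
  let ?P = "PiE {1..<n} (\<lambda>_. UNIV :: nat set)"
  have s: "(\<lambda>k. x ^ k / fact k) abs_summable_on (UNIV :: nat set)" for x :: real
    using summable_norm_exp[of x] by (simp add: abs_summable_on_nat_iff' divide_inverse mult.commute)
  have e: "infsetsum (\<lambda>k. x ^ k / fact k) (UNIV :: nat set) = exp x" for x :: real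
    unfolding infsetsum_nat'[OF s] exp_def by (simp add: divide_inverse mult.commute)
  have cong: "(\<Prod>i\<in>{1..<n}. t i ^ (if i \<in> {1..<n} then b i else 0) / fact (if i \<in> {1..<n} then b i else 0)) =
      (\<Prod>i\<in>{1..<n}. t i ^ b i / fact (b i))" for b
    by (rule prod.cong) auto
  have "(\<lambda>b. \<Prod>i\<in>{1..<n}. t i ^ b i / fact (b i)) abs_summable_on ?P"
    using s by (intro abs_summable_on_prod_PiE) auto
  then show "(\<lambda>b. \<Prod>i\<in>{1..<n}. t i ^ b i / fact (b i)) abs_summable_on multi_exponents n"
    by (subst abs_summable_on_reindex_bij_betw[OF bij_betw_multi_exponents, symmetric])
      (simp only: cong)
  have "infsetsum (\<lambda>b. \<Prod>i\<in>{1..<n}. t i ^ b i / fact (b i)) ?P = (\<Prod>i\<in>{1..<n}. exp (t i))"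
    using s by (subst infsetsum_prod_PiE) (auto simp: e)
  then show "infsetsum (\<lambda>b. \<Prod>i\<in>{1..<n}. t i ^ b i / fact (b i)) (multi_exponents n) = exp (\<Sum>i\<in>{1..<n}. t i)"
    by (subst infsetsum_reindex_bij_betw[OF bij_betw_multi_exponents, symmetric])
      (simp only: cong exp_sum finite_atLeastLessThan)
qed

text \<open>The variable \<open>x i\<close> occurs with exponent \<open>b (i - 1)\<close> in one
  factor and \<open>b i\<close> in the next; the boundary values \<open>b 0 = b n = 0\<close> make
  this uniform at both ends.\<close>

lemma prod_consecutive_powers:
  fixes x :: "nat \<Rightarrow> 'a::comm_semiring_1"
  assumes "b 0 = 0" "b n = 0" "1 \<le> n"
  shows "(\<Prod>i\<in>{1..<n}. (x i * x (i + 1)) ^ b i) = (\<Prod>i\<in>{1..n}. x i ^ (b (i - 1) + b i))"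
proof -
  have "(\<Prod>i\<in>{1..n}. x i ^ b i) = (\<Prod>i\<in>{1..<n}. x i ^ b i)"
    using assms by (intro prod.mono_neutral_right) auto
  moreover have "(\<Prod>i\<in>{1..n}. x i ^ b (i - 1)) = (\<Prod>i\<in>{2..n}. x i ^ b (i - 1))"
    using assms by (intro prod.mono_neutral_right) (auto simp: not_le less_Suc_eq numeral_2_eq_2)
  moreover have "(\<Prod>i\<in>{2..n}. x i ^ b (i - 1)) = (\<Prod>i\<in>{1..<n}. x (i + 1) ^ b i)"
    by (rule prod.reindex_bij_witness[of _ "\<lambda>i. i + 1" "\<lambda>i. i - 1"]) auto
  ultimately show ?thesis
    by (simp add: power_mult_distrib prod.distrib power_add mult.commute)
qed

text \<open>Coordinates indexed by \<open>{1..n}\<close>; outside this range the index \<open>inv pos i\<close> is meaningless.\<close>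

definition coord :: "real^'n \<Rightarrow> nat \<Rightarrow> real" where
  "coord y i = y $ inv pos i"

lemma coord_pos [simp]: "coord (y :: real^'n) (pos i) = y $ i"
  using bij_betw_pos[where 'n = 'n] by (simp add: coord_def bij_betw_def)

lemma coord_measurable [measurable]: "(\<lambda>y. coord y i) \<in> borel_measurable borel"
  unfolding coord_def by (intro borel_measurable_continuous_onI) (simp add: continuous_on_component continuous_on_id)

definition orthant :: "(real^'n) set" where
  "orthant = {y. \<forall>i. 0 \<le> y $ i}"

lemma mem_orthant_iff: "(y :: real^'n) \<in> orthant \<longleftrightarrow> (\<forall>i\<in>{1..CARD('n)}. 0 \<le> coord y i)"
proof -
  have "(\<forall>i\<in>{1..CARD('n)}. 0 \<le> coord y i) \<longleftrightarrow> (\<forall>i\<in>range (pos :: 'n \<Rightarrow> nat). 0 \<le> coord y i)"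
    using bij_betw_pos[where 'n = 'n] by (simp add: bij_betw_def)
  then show ?thesis
    by (simp add: orthant_def)
qed

lemma orthant_measurable [measurable]: "(orthant :: (real^'n) set) \<in> sets borel"
proof -
  have "closed (orthant :: (real^'n) set)"
    unfolding orthant_def by (intro closed_Collect_all closed_Collect_le continuous_intros)
  then show ?thesis by simp
qed

text \<open>For a chain whose vectors \<open>i\<close> and \<open>i + 1\<close> have inner product
  \<open>\<gamma> i\<close>, this is the squared norm of the combination with coefficients
  \<open>y\<close>.\<close>

definition chain_form :: "(nat \<Rightarrow> real) \<Rightarrow> real^'n \<Rightarrow> real" where
  "chain_form \<gamma> y =
     (\<Sum>i\<in>{1..CARD('n)}. (coord y i)\<^sup>2) + 2 * (\<Sum>i\<in>{1..<CARD('n)}. \<gamma> i * (coord y i * coord y (i + 1)))"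

lemma chain_form_measurable [measurable]: "chain_form \<gamma> \<in> borel_measurable borel"
  unfolding chain_form_def[abs_def] by measurable

text \<open>The coefficients \<open>\<gamma>\<close> take the place of the consecutive inner
  products in \<open>simplified_term\<close>, so that the analysis depends on the quadratic form
  alone.\<close>

definition chain_term :: "nat \<Rightarrow> (nat \<Rightarrow> real) \<Rightarrow> (nat \<Rightarrow> nat) \<Rightarrow> real" where
  "chain_term n \<gamma> b =
     (-2) ^ (\<Sum>i\<in>{1..<n}. b i) / (\<Prod>i\<in>{1..<n}. fact (b i))
     * (\<Prod>i\<in>{1..n}. Gamma ((1 + real (b (i - 1)) + real (b i)) / 2))
     * (\<Prod>i\<in>{1..<n}. \<gamma> i ^ b i)"

text \<open>On the orthant, the absolute value of a term of the exponential expansion for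
  \<open>\<gamma>\<close> is the term for \<open>- \<bar>\<gamma> i\<bar>\<close>. Tonelli thus
  turns \<open>fin\<close> into joint integrability, Fubini exchanges sum and integral, and each
  term integrates to a product of one-dimensional moments.\<close>

lemma
  fixes \<gamma> :: "nat \<Rightarrow> real"
  assumes fin: "(\<integral>\<^sup>+y. ennreal (indicator orthant y * exp (- chain_form (\<lambda>i. - \<bar>\<gamma> i\<bar>) y)) \<partial>(lborel :: (real^'n) measure)) < \<infinity>"
  shows abs_summable_chain_term: "chain_term CARD('n) \<gamma> abs_summable_on multi_exponents CARD('n)"
    and infsetsum_chain_term: "infsetsum (chain_term CARD('n) \<gamma>) (multi_exponents CARD('n)) =
      2 ^ CARD('n) * (\<integral>y. indicator orthant y * exp (- chain_form \<gamma> y) \<partial>(lborel :: (real^'n) measure))"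
proof -
  let ?n = "CARD('n)" and ?M = "lborel :: (real^'n) measure"
  let ?E = "multi_exponents ?n"
  define u where "u = (\<lambda>(\<delta> :: nat \<Rightarrow> real) (y :: real^'n) i. - 2 * \<delta> i * (coord y i * coord y (i + 1)))"
  define g where "g = (\<lambda>y :: real^'n. indicator orthant y * exp (- (\<Sum>i\<in>{1..?n}. (coord y i)\<^sup>2)))"
  \<comment> \<open>\<open>T\<close> is a term of the expanded integrand. On multi-exponents it
    factors as the constant \<open>k\<close> times the monomial Gaussian \<open>m\<close>, whose
    integral is \<open>G\<close>.\<close>
  define T where "T = (\<lambda>\<delta> b y. g y * (\<Prod>i\<in>{1..<?n}. u \<delta> y i ^ b i / fact (b i)))"
  define k where "k = (\<lambda>(\<delta> :: nat \<Rightarrow> real) (b :: nat \<Rightarrow> nat). \<Prod>i\<in>{1..<?n}. (- 2 * \<delta> i) ^ b i / fact (b i))"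
  define m where "m = (\<lambda>b (y :: real^'n). \<Prod>i\<in>{1..?n}. indicator {0..} (coord y i) * (coord y i ^ (b (i - 1) + b i) * exp (- (coord y i)\<^sup>2)))"
  define G where "G = (\<lambda>b. \<Prod>i\<in>{1..?n}. Gamma ((1 + real (b (i - 1)) + real (b i)) / 2) / 2)"
  let ?\<gamma>' = "\<lambda>i. - \<bar>\<gamma> i\<bar>"
  have g0: "0 \<le> g y" for y
    by (simp add: g_def)
  have g: "g y = (\<Prod>i\<in>{1..?n}. indicator {0..} (coord y i) * exp (- (coord y i)\<^sup>2))" for y
  proof (cases "y \<in> orthant")
    case True
    then have "indicator {0..} (coord y i) = (1::real)" if "i \<in> {1..?n}" for i
      using that by (auto simp: mem_orthant_iff)
    then show ?thesis
      using True by (simp add: g_def exp_sum flip: sum_negf)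
  next
    case False
    then show ?thesis
      by (auto simp: g_def mem_orthant_iff intro!: prod_zero[symmetric] bexI)
  qed
  have form: "g y * exp (\<Sum>i\<in>{1..<?n}. u \<delta> y i) = indicator orthant y * exp (- chain_form \<delta> y)" for \<delta> y
    unfolding g_def chain_form_def u_def minus_add_distrib exp_add
    by (simp add: sum_distrib_left sum_negf[symmetric] mult_ac del: sum_negf)
  have T_sum: "(\<lambda>b. T \<delta> b y) abs_summable_on ?E"
    "infsetsum (\<lambda>b. T \<delta> b y) ?E = indicator orthant y * exp (- chain_form \<delta> y)" for \<delta> y
    unfolding T_def form[symmetric]
    using abs_summable_exp_multi[of "u \<delta> y" ?n] infsetsum_exp_multi[of "u \<delta> y" ?n]
    by (auto intro: abs_summable_on_cmult_right simp: infsetsum_cmult_right)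
  \<comment> \<open>The factor \<open>- 2 * \<delta> i\<close> becomes nonnegative for
    \<open>\<delta> i = - \<bar>\<gamma> i\<bar>\<close>, and coordinates in the orthant are
    nonnegative; off the orthant both sides vanish.\<close>
  have T_norm: "norm (T \<gamma> b y) = T ?\<gamma>' b y" for b y
  proof (cases "y \<in> orthant")
    case True
    then have "u ?\<gamma>' y i = \<bar>u \<gamma> y i\<bar>" if "i \<in> {1..<?n}" for i
      using that by (auto simp: u_def mem_orthant_iff abs_mult)
    then show ?thesis
      using g0[of y] by (simp add: T_def abs_mult abs_prod power_abs)
  qed (simp add: T_def g_def)
  have T_factor: "T \<delta> b y = k \<delta> b * m b y" if "b \<in> ?E" for \<delta> b y
  proof -
    have "(\<Prod>i\<in>{1..<?n}. u \<delta> y i ^ b i / fact (b i)) =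
      k \<delta> b * (\<Prod>i\<in>{1..<?n}. (coord y i * coord y (i + 1)) ^ b i)"
      unfolding k_def u_def prod.distrib[symmetric]
      by (rule prod.cong) (simp_all only: power_mult_distrib times_divide_eq_left)
    also have "(\<Prod>i\<in>{1..<?n}. (coord y i * coord y (i + 1)) ^ b i) = (\<Prod>i\<in>{1..?n}. coord y i ^ (b (i - 1) + b i))"
      using that by (intro prod_consecutive_powers) (auto simp: multi_exponents_def Suc_leI)
    finally show ?thesis
      unfolding T_def g m_def by (simp add: prod.distrib mult_ac)
  qed
  have m_meas [measurable]: "m b \<in> borel_measurable borel" for b
    unfolding m_def by measurable
  have m0: "0 \<le> m b y" for b y
    unfolding m_def by (intro prod_nonneg) (auto simp: indicator_def)
  have G0: "0 \<le> G b" for b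
    unfolding G_def by (intro prod_nonneg ballI divide_nonneg_nonneg less_imp_le[OF Gamma_real_pos]) auto
  have m_int: "(\<integral>\<^sup>+y. ennreal (m b y) \<partial>?M) = ennreal (G b)" for b
  proof -
    define p where "p = (\<lambda>i t::real. indicator {0..} t * (t ^ (b (i - 1) + b i) * exp (- t\<^sup>2)))"
    have p0: "0 \<le> p i t" for i t
      by (auto simp: p_def indicator_def)
    have "m b y = (\<Prod>j\<in>UNIV. p (pos j) (y $ j))" for y
      unfolding m_def using prod.reindex_bij_betw[OF bij_betw_pos[where 'n = 'n], of "\<lambda>i. p i (coord y i)"]
      by (simp only: p_def coord_pos)
    then have "(\<integral>\<^sup>+y. ennreal (m b y) \<partial>?M) = (\<integral>\<^sup>+y. (\<Prod>j\<in>UNIV. ennreal (p (pos j) (y $ j))) \<partial>?M)"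
      using p0 by (simp add: prod_ennreal)
    also have "\<dots> = (\<Prod>j\<in>UNIV. \<integral>\<^sup>+t. ennreal (p (pos (j :: 'n)) t) \<partial>lborel)"
      by (rule nn_integral_lborel_prod_cart) (simp add: p_def)
    also have "\<dots> = (\<Prod>j\<in>(UNIV :: 'n set). ennreal (Gamma ((1 + real (b (pos j - 1)) + real (b (pos j))) / 2) / 2))"
      unfolding p_def nn_integral_power_gaussian by (simp add: add.assoc)
    also have "\<dots> = (\<Prod>i\<in>{1..?n}. ennreal (Gamma ((1 + real (b (i - 1)) + real (b i)) / 2) / 2))"
      by (rule prod.reindex_bij_betw[OF bij_betw_pos])
    also have "\<dots> = ennreal (G b)"
      unfolding G_def by (intro prod_ennreal divide_nonneg_nonneg less_imp_le[OF Gamma_real_pos]) auto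
    finally show ?thesis .
  qed
  have m_integrable: "has_bochner_integral ?M (m b) (G b)" for b
    using m_int[of b] m0 G0 by (intro has_bochner_integral_nn_integral) auto
  \<comment> \<open>Each of the \<open>n\<close> moments contributes a factor \<open>1 / 2\<close>,
    which accounts for the power of two.\<close>
  have kG: "k \<gamma> b * G b = chain_term ?n \<gamma> b / 2 ^ ?n" for b
  proof -
    have "k \<gamma> b = (-2) ^ (\<Sum>i\<in>{1..<?n}. b i) / (\<Prod>i\<in>{1..<?n}. fact (b i)) * (\<Prod>i\<in>{1..<?n}. \<gamma> i ^ b i)"
      unfolding k_def power_mult_distrib prod_dividef prod.distrib by (simp add: power_sum)
    moreover have "G b = (\<Prod>i\<in>{1..?n}. Gamma ((1 + real (b (i - 1)) + real (b i)) / 2)) / 2 ^ ?n"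
      unfolding G_def prod_dividef by simp
    ultimately show ?thesis
      by (simp add: chain_term_def)
  qed
  have T_meas: "T \<delta> b \<in> borel_measurable borel" if "b \<in> ?E" for \<delta> b
    using T_factor[OF that, of \<delta>] by (simp add: fun_eq_iff[of "T \<delta> b" "\<lambda>y. k \<delta> b * m b y", THEN iffD2])
  interpret pair_sigma_finite "count_space ?E" ?M
    by (intro pair_sigma_finite.intro sigma_finite_measure_count_space_countable countable_multi_exponents sigma_finite_lborel)
  have meas: "case_prod (T \<gamma>) \<in> borel_measurable (count_space ?E \<Otimes>\<^sub>M ?M)"
    by (rule measurable_pair_measure_countable1[OF countable_multi_exponents]) (simp add: T_meas)
  \<comment> \<open>Summing the norms first gives the Gaussian integrand of the form with
    coefficients \<open>- \<bar>\<gamma> i\<bar>\<close>, whose integral is finite by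
    \<open>fin\<close>.\<close>
  have "integrable (count_space ?E \<Otimes>\<^sub>M ?M) (case_prod (T \<gamma>))"
  proof (rule integrableI_bounded)
    have "(\<integral>\<^sup>+p. ennreal (norm (case_prod (T \<gamma>) p)) \<partial>(count_space ?E \<Otimes>\<^sub>M ?M)) =
          (\<integral>\<^sup>+y. (\<integral>\<^sup>+b. ennreal (norm (T \<gamma> b y)) \<partial>count_space ?E) \<partial>?M)"
      using meas by (subst nn_integral_snd[symmetric]) auto
    also have "\<dots> = (\<integral>\<^sup>+y. ennreal (indicator orthant y * exp (- chain_form ?\<gamma>' y)) \<partial>?M)"
    proof (rule nn_integral_cong)
      fix y :: "real^'n"
      have "(\<integral>\<^sup>+b. ennreal (norm (T \<gamma> b y)) \<partial>count_space ?E) = ennreal (infsetsum (\<lambda>b. T ?\<gamma>' b y) ?E)"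
        using T_sum(1)[of ?\<gamma>' y] unfolding infsetsum_def abs_summable_on_def T_norm
        by (intro nn_integral_eq_integral) (auto simp flip: T_norm)
      then show "(\<integral>\<^sup>+b. ennreal (norm (T \<gamma> b y)) \<partial>count_space ?E) = ennreal (indicator orthant y * exp (- chain_form ?\<gamma>' y))"
        by (simp only: T_sum)
    qed
    finally show "(\<integral>\<^sup>+p. ennreal (norm (case_prod (T \<gamma>) p)) \<partial>(count_space ?E \<Otimes>\<^sub>M ?M)) < \<infinity>"
      using fin by simp
  qed (rule meas)
  note int = this
  have inner: "(\<integral>y. T \<gamma> b y \<partial>?M) = chain_term ?n \<gamma> b / 2 ^ ?n" if "b \<in> ?E" for b
    using that m_integrable[of b] by (simp add: T_factor kG[symmetric] has_bochner_integral_iff)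
  have "integrable (count_space ?E) (\<lambda>b. chain_term ?n \<gamma> b / 2 ^ ?n)"
    using integrable_fst'[OF int]
    by (subst Bochner_Integration.integrable_cong[OF refl, of _ _ "\<lambda>b. \<integral>y. T \<gamma> b y \<partial>?M"]) (simp_all add: inner)
  then have "integrable (count_space ?E) (\<lambda>b. chain_term ?n \<gamma> b / 2 ^ ?n * 2 ^ ?n)"
    by (rule integrable_mult_left)
  then show "chain_term ?n \<gamma> abs_summable_on ?E"
    by (simp add: abs_summable_on_def)
  have "(\<integral>y. indicator orthant y * exp (- chain_form \<gamma> y) \<partial>?M) = (\<integral>y. (\<integral>b. T \<gamma> b y \<partial>count_space ?E) \<partial>?M)"
    using T_sum(2)[of \<gamma>] by (simp add: infsetsum_def)
  also have "\<dots> = (\<integral>b. (\<integral>y. T \<gamma> b y \<partial>?M) \<partial>count_space ?E)"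
    by (rule Fubini_integral[OF int])
  also have "\<dots> = (\<integral>b. chain_term ?n \<gamma> b / 2 ^ ?n \<partial>count_space ?E)"
    by (rule Bochner_Integration.integral_cong) (auto simp: inner)
  finally show "infsetsum (chain_term ?n \<gamma>) ?E = 2 ^ ?n * (\<integral>y. indicator orthant y * exp (- chain_form \<gamma> y) \<partial>?M)"
    by (simp add: infsetsum_def)
qed

subsection \<open>Solid angles of simplicial cones\<close>

text \<open>A new vector is orthogonal to all earlier ones except its neighbour, so it contributes
  one square and one mixed term.\<close>

lemma norm_chain_family:
  assumes "chain_family n v"
  shows "(norm (\<Sum>i\<in>{1..n}. c i *\<^sub>R v i))\<^sup>2 =
    (\<Sum>i\<in>{1..n}. (c i)\<^sup>2) + 2 * (\<Sum>i\<in>{1..<n}. (v i \<bullet> v (i + 1)) * (c i * c (i + 1)))"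
  using assms
proof (induction n)
  case (Suc n)
  then have IH: "(norm (\<Sum>i\<in>{1..n}. c i *\<^sub>R v i))\<^sup>2 =
    (\<Sum>i\<in>{1..n}. (c i)\<^sup>2) + 2 * (\<Sum>i\<in>{1..<n}. (v i \<bullet> v (i + 1)) * (c i * c (i + 1)))"
    by (auto simp: chain_family_def)
  have n1: "norm (v (Suc n)) = 1"
    using Suc.prems by (auto simp: chain_family_def)
  let ?s = "\<Sum>i\<in>{1..n}. c i *\<^sub>R v i"
  have "(norm (?s + c (Suc n) *\<^sub>R v (Suc n)))\<^sup>2 =
      (norm ?s)\<^sup>2 + 2 * (?s \<bullet> (c (Suc n) *\<^sub>R v (Suc n))) + (c (Suc n))\<^sup>2"
    using n1 by (simp add: power2_norm_eq_inner inner_simps power_mult_distrib norm_eq_1)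
      (simp add: power2_eq_square algebra_simps inner_commute)
  also have "?s \<bullet> (c (Suc n) *\<^sub>R v (Suc n)) = (\<Sum>i\<in>{1..n}. (v i \<bullet> v (Suc n)) * (c i * c (Suc n)))"
    by (simp add: inner_sum_left inner_sum_right sum_distrib_left mult_ac)
  also have "\<dots> = (\<Sum>i\<in>{1..n}. if i = n then (v n \<bullet> v (Suc n)) * (c n * c (Suc n)) else 0)"
    using Suc.prems by (intro sum.cong) (auto simp: chain_family_def)
  also have "\<dots> = (if 1 \<le> n then (v n \<bullet> v (Suc n)) * (c n * c (Suc n)) else 0)"
    by simp
  finally show ?case
    using IH by (cases "1 \<le> n") (auto simp: not_le)
qed simp

section \<open>Simplicial cones as linear images of the orthant\<close>

lemma gen_matrix_mult: "gen_matrix v *v y = (\<Sum>i\<in>{1..CARD('n)}. coord y i *\<^sub>R (v i :: real^'n))"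
proof -
  have "gen_matrix v *v y = (\<Sum>j\<in>UNIV. coord y (pos j) *\<^sub>R v (pos (j :: 'n)))"
    by (simp add: vec_eq_iff matrix_vector_mult_def gen_matrix_def mult.commute)
  also have "\<dots> = (\<Sum>i\<in>{1..CARD('n)}. coord y i *\<^sub>R v i)"
    by (rule sum.reindex_bij_betw[OF bij_betw_pos])
  finally show ?thesis .
qed

lemma coord_surj: "\<exists>y :: real^'n. \<forall>i\<in>{1..CARD('n)}. coord y i = c i"
proof (intro exI ballI)
  fix i assume "i \<in> {1..CARD('n)}"
  then obtain j :: 'n where "i = pos j"
    using bij_betw_imp_surj_on[OF bij_betw_pos[where 'n = 'n]] by blast
  then show "coord (\<chi> j :: 'n. c (pos j)) i = c i"
    by simp
qed

lemma gen_cone_eq_image: "gen_cone v = (\<lambda>y. gen_matrix v *v y) ` orthant"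
proof (intro equalityI subsetI)
  fix x assume "x \<in> gen_cone v"
  then obtain c where c: "x = (\<Sum>i\<in>{1..CARD('a)}. c i *\<^sub>R v i)" "\<forall>i\<in>{1..CARD('a)}. 0 \<le> c i"
    by (auto simp: gen_cone_def)
  obtain y :: "real^'a" where y: "\<forall>i\<in>{1..CARD('a)}. coord y i = c i"
    using coord_surj by blast
  have "x = gen_matrix v *v y" "y \<in> orthant"
    unfolding gen_matrix_mult mem_orthant_iff c(1) using c(2) y by auto
  then show "x \<in> (\<lambda>y. gen_matrix v *v y) ` orthant"
    by blast
next
  fix x assume "x \<in> (\<lambda>y. gen_matrix v *v y) ` orthant"
  then show "x \<in> gen_cone v"
    by (auto simp: gen_cone_def gen_matrix_mult mem_orthant_iff)
qed

lemma det_gen_matrix_nonzero: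
  fixes v :: "nat \<Rightarrow> real^'n"
  assumes "indep_family {1..CARD('n)} v"
  shows "det (gen_matrix v) \<noteq> 0"
proof -
  have "y = 0" if "gen_matrix v *v y = 0" for y
  proof -
    have "\<forall>i\<in>{1..CARD('n)}. coord y i = 0"
      using that assms by (auto simp: gen_matrix_mult indep_family_def)
    then have "\<forall>j. y $ j = 0"
      using bij_betw_pos[where 'n = 'n] by (metis coord_pos bij_betwE UNIV_I)
    then show ?thesis
      by (simp add: vec_eq_iff)
  qed
  then show ?thesis
    using matrix_left_invertible_ker[of "gen_matrix v"] matrix_left_right_inverse[of _ "gen_matrix v"]
    by (metis invertible_def invertible_det_nz)
qed

lemma convex_cone_gen_cone: "convex_cone (gen_cone v)"
proof -
  have "convex_cone (orthant :: (real^'a) set)"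
    by (auto simp: convex_cone_iff orthant_def)
  then show ?thesis
    unfolding gen_cone_eq_image by (intro convex_cone_linear_image) auto
qed

text \<open>As the hull of a finite set the cone is polyhedral, hence closed and Borel.\<close>

lemma gen_cone_eq_hull: "gen_cone (v :: nat \<Rightarrow> real^'n) = convex_cone hull (v ` {1..CARD('n)})"
proof (rule hull_unique[symmetric])
  show "v ` {1..CARD('n)} \<subseteq> gen_cone v"
  proof
    fix x assume "x \<in> v ` {1..CARD('n)}"
    then obtain k where k: "k \<in> {1..CARD('n)}" "x = v k" by blast
    have "x = (\<Sum>i\<in>{1..CARD('n)}. (if i = k then 1 else 0) *\<^sub>R v i)"
      using k by (simp add: if_distrib[of "\<lambda>c. c *\<^sub>R _"] cong: if_cong)
    then show "x \<in> gen_cone v"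
      unfolding gen_cone_def by (intro CollectI exI[of _ "\<lambda>i. if i = k then 1 else 0"]) auto
  qed
  show "gen_cone v \<subseteq> K" if "v ` {1..CARD('n)} \<subseteq> K" "convex_cone K" for K
  proof
    fix x assume "x \<in> gen_cone v"
    then obtain c where c: "x = (\<Sum>i\<in>{1..CARD('n)}. c i *\<^sub>R v i)" "\<forall>i\<in>{1..CARD('n)}. 0 \<le> c i"
      by (auto simp: gen_cone_def)
    have "(\<Sum>i\<in>S. c i *\<^sub>R v i) \<in> K" if "S \<subseteq> {1..CARD('n)}" "finite S" for S
      using that(2,1)
    proof (induction S)
      case empty
      then show ?case using \<open>convex_cone K\<close> by (simp add: convex_cone_contains_0)
    next
      case (insert i S)
      then show ?case
        using c(2) \<open>v ` {1..CARD('n)} \<subseteq> K\<close>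
        by (auto intro!: convex_cone_add[OF \<open>convex_cone K\<close>] convex_cone_scaleR[OF \<open>convex_cone K\<close>])
    qed
    then show "x \<in> K"
      using c(1) by auto
  qed
qed (rule convex_cone_gen_cone)

lemma polyhedron_gen_cone: "polyhedron (gen_cone v)"
  unfolding gen_cone_eq_hull by (intro polyhedron_convex_cone_hull) simp

lemma gen_cone_borel [measurable]: "gen_cone v \<in> sets borel"
  by (intro borel_closed polyhedron_imp_closed polyhedron_gen_cone)

lemma aff_dim_gen_cone:
  fixes v :: "nat \<Rightarrow> real^'n"
  assumes "indep_family {1..CARD('n)} v"
  shows "aff_dim (gen_cone v) = int CARD('n)"
proof -
  \<comment> \<open>The open orthant has full dimension, and the injective generator matrix
    preserves dimensions.\<close>
  let ?O = "{y :: real^'n. \<forall>i. 0 < y $ i}"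
  have "?O = (\<Inter>i. {y. 0 < y $ i})" by auto
  then have "open ?O"
    by (auto intro!: open_INT open_Collect_less continuous_intros)
  moreover have "(\<chi> i. 1) \<in> ?O" by simp
  then have "?O \<noteq> {}" by blast
  ultimately have "aff_dim ?O = int DIM(real^'n)"
    by (rule aff_dim_open)
  moreover have "aff_dim ?O \<le> aff_dim (orthant :: (real^'n) set)"
    by (rule aff_dim_subset) (auto simp: orthant_def less_imp_le)
  moreover have "aff_dim (orthant :: (real^'n) set) \<le> int CARD('n)"
    using aff_dim_le_DIM[of "orthant :: (real^'n) set"] by simp
  moreover have "inj ((*v) (gen_matrix v))"
    using det_gen_matrix_nonzero[OF assms] by (simp add: inj_matrix_vector_mult invertible_det_nz)
  ultimately show ?thesis
    unfolding gen_cone_eq_image by (subst aff_dim_injective_linear_image) auto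
qed

text \<open>Substituting the generator matrix in the Gaussian formula pulls the integral back to the
  orthant, with the determinant as Jacobian.\<close>

lemma solid_angle_gen_cone:
  fixes v :: "nat \<Rightarrow> real^'n"
  assumes "indep_family {1..CARD('n)} v"
  shows "solid_angle (gen_cone v) = \<bar>det (gen_matrix v)\<bar> *
    (\<integral>y. indicator orthant y * exp (- (norm (gen_matrix v *v y))\<^sup>2) \<partial>(lborel :: (real^'n) measure))
    / pi powr (real CARD('n) / 2)"
proof -
  let ?V = "gen_matrix v"
  have inj: "inj ((*v) ?V)"
    using det_gen_matrix_nonzero[OF assms] by (simp add: inj_matrix_vector_mult invertible_det_nz)
  have ind: "indicator (gen_cone v) (?V *v y) = (indicator orthant y :: real)" for y
    unfolding gen_cone_eq_image using inj by (auto simp: indicator_def inj_def)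
  have [measurable]: "(\<lambda>y. ?V *v y) \<in> borel_measurable borel"
    by (intro borel_measurable_continuous_onI linear_continuous_on matrix_vector_mul_bounded_linear)
  have "(\<integral>x\<in>gen_cone v. exp (- (norm x)\<^sup>2) \<partial>lborel) =
    enn2real (\<integral>\<^sup>+x. ennreal (indicator (gen_cone v) x * exp (- (norm x)\<^sup>2)) \<partial>lborel)"
    unfolding set_lebesgue_integral_def by (subst integral_eq_nn_integral) auto
  also have "(\<integral>\<^sup>+x. ennreal (indicator (gen_cone v) x * exp (- (norm x)\<^sup>2)) \<partial>lborel) =
    ennreal \<bar>det ?V\<bar> * (\<integral>\<^sup>+y. ennreal (indicator orthant y * exp (- (norm (?V *v y))\<^sup>2)) \<partial>lborel)"
    by (subst nn_integral_lborel_matrix[OF _ det_gen_matrix_nonzero[OF assms]]) (simp_all add: ind)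
  also have "enn2real \<dots> = \<bar>det ?V\<bar> * (\<integral>y. indicator orthant y * exp (- (norm (?V *v y))\<^sup>2) \<partial>lborel)"
    by (subst integral_eq_nn_integral) (auto simp: enn2real_mult)
  finally show ?thesis
    using solid_angle_gaussian[of "gen_cone v"] convex_cone_gen_cone[of v]
    by (simp add: convex_cone_def)
qed

text \<open>The coefficient \<open>\<gamma> i\<close> links only \<open>i\<close> and
  \<open>Suc i\<close>. As this graph is a path, signs can be chosen successively to make every link
  nonpositive; \<open>\<gamma> 0\<close> changes the signs from index \<open>1\<close> on by a
  common factor.\<close>

fun chain_sign :: "(nat \<Rightarrow> real) \<Rightarrow> nat \<Rightarrow> real" where
  "chain_sign \<gamma> 0 = 1"
| "chain_sign \<gamma> (Suc i) = (if 0 < \<gamma> i then - chain_sign \<gamma> i else chain_sign \<gamma> i)"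

lemma chain_sign_values: "chain_sign \<gamma> i \<in> {-1, 1}"
  by (induction i) auto

lemma chain_sign_product: "chain_sign \<gamma> i * chain_sign \<gamma> (Suc i) * \<gamma> i = - \<bar>\<gamma> i\<bar>"
  using chain_sign_values[of \<gamma> i] by auto

text \<open>For a chain, these are the vectors whose Gram matrix is \<open>assoc_matrix\<close>;
  they give property (e).\<close>

definition signed_chain :: "(nat \<Rightarrow> 'a::real_inner) \<Rightarrow> nat \<Rightarrow> 'a" where
  "signed_chain v i = chain_sign (\<lambda>i. v i \<bullet> v (i + 1)) i *\<^sub>R v i"

lemma signed_chain_inner: "signed_chain v i \<bullet> signed_chain v (i + 1) = - \<bar>v i \<bullet> v (i + 1)\<bar>"
  using chain_sign_product[of "\<lambda>i. v i \<bullet> v (i + 1)" i] by (simp add: signed_chain_def mult_ac del: chain_sign.simps)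

lemma chain_sign_nonzero: "chain_sign \<gamma> i \<noteq> 0" "\<bar>chain_sign \<gamma> i\<bar> = 1"
  using chain_sign_values[of \<gamma> i] by auto

lemma chain_family_signed_chain: "chain_family n v \<Longrightarrow> chain_family n (signed_chain v)"
  by (simp add: chain_family_def signed_chain_def chain_sign_nonzero)

lemma indep_family_signed_chain:
  assumes "indep_family I v"
  shows "indep_family I (signed_chain v)"
  unfolding indep_family_def
proof (intro allI impI)
  fix c assume "(\<Sum>i\<in>I. c i *\<^sub>R signed_chain v i) = 0"
  then have "\<forall>i\<in>I. c i * chain_sign (\<lambda>i. v i \<bullet> v (i + 1)) i = 0"
    using assms[unfolded indep_family_def, rule_format, of "\<lambda>i. c i * chain_sign (\<lambda>i. v i \<bullet> v (i + 1)) i"]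
    by (simp add: signed_chain_def)
  then show "\<forall>i\<in>I. c i = 0"
    using chain_sign_nonzero by auto
qed

lemma norm_gen_matrix_chain:
  fixes v :: "nat \<Rightarrow> real^'n"
  assumes "chain_family CARD('n) v"
  shows "(norm (gen_matrix v *v y))\<^sup>2 = chain_form (\<lambda>i. v i \<bullet> v (i + 1)) y"
  unfolding gen_matrix_mult norm_chain_family[OF assms] chain_form_def ..

text \<open>The form with coefficients \<open>- \<bar>?\<gamma> i\<bar>\<close> is the Gram form of
  the independent vectors \<open>signed_chain v\<close>. Its integral over the orthant is at most
  the total Gaussian integral divided by a nonzero determinant, so the termwise integration
  applies.\<close>

lemma
  fixes v :: "nat \<Rightarrow> real^'n"
  assumes chain: "chain_family CARD('n) v" and ind: "indep_family {1..CARD('n)} v"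
  shows summable_simplified_term:
      "(\<lambda>b. \<bar>simplified_term v b\<bar>) summable_on multi_exponents CARD('n)"
    and simplified_series_eq_solid_angle: "simplified_series v = solid_angle (gen_cone v)"
proof -
  let ?\<gamma> = "\<lambda>i. v i \<bullet> v (i + 1)" and ?u = "signed_chain v"
  have u: "(norm (gen_matrix ?u *v y))\<^sup>2 = chain_form (\<lambda>i. - \<bar>?\<gamma> i\<bar>) y" for y
    using norm_gen_matrix_chain[OF chain_family_signed_chain[OF chain]] unfolding signed_chain_inner .
  have du: "det (gen_matrix ?u) \<noteq> 0"
    by (intro det_gen_matrix_nonzero indep_family_signed_chain ind)
  have "(\<integral>\<^sup>+y. ennreal (indicator orthant y * exp (- chain_form (\<lambda>i. - \<bar>?\<gamma> i\<bar>) y)) \<partial>(lborel :: (real^'n) measure)) \<le>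
    (\<integral>\<^sup>+y. ennreal (exp (- (norm (gen_matrix ?u *v y))\<^sup>2)) \<partial>lborel)"
    unfolding u by (intro nn_integral_mono ennreal_leI) (auto simp: indicator_def)
  also have "\<dots> < \<infinity>"
  proof -
    have "ennreal \<bar>det (gen_matrix ?u)\<bar> * (\<integral>\<^sup>+y. ennreal (exp (- (norm (gen_matrix ?u *v y))\<^sup>2)) \<partial>lborel) =
      (\<integral>\<^sup>+x. ennreal (exp (- (norm x)\<^sup>2)) \<partial>(lborel :: (real^'n) measure))"
      using du by (subst nn_integral_lborel_matrix[of _ "gen_matrix ?u"]) auto
    then have "ennreal \<bar>det (gen_matrix ?u)\<bar> * (\<integral>\<^sup>+y. ennreal (exp (- (norm (gen_matrix ?u *v y))\<^sup>2)) \<partial>lborel) < \<infinity>"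
      by (simp add: nn_integral_gaussian)
    then show ?thesis
      using du by (auto simp: ennreal_mult_less_top)
  qed
  finally have fin: "(\<integral>\<^sup>+y. ennreal (indicator orthant y * exp (- chain_form (\<lambda>i. - \<bar>?\<gamma> i\<bar>) y)) \<partial>(lborel :: (real^'n) measure)) < \<infinity>" .
  have eq: "simplified_term v = chain_term CARD('n) ?\<gamma>"
    by (simp add: fun_eq_iff simplified_term_def chain_term_def)
  note abs = abs_summable_chain_term[OF fin, folded eq]
  show "(\<lambda>b. \<bar>simplified_term v b\<bar>) summable_on multi_exponents CARD('n)"
    using abs_summable_equivalent[of "simplified_term v"] abs by simp
  \<comment> \<open>The factor \<open>2 ^ CARD('n)\<close> from the half-line moments turns
    \<open>pi\<close> into \<open>4 * pi\<close>.\<close>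
  have "(4 * pi) powr (real CARD('n) / 2) = 2 ^ CARD('n) * pi powr (real CARD('n) / 2)"
  proof -
    have "(4 :: real) powr (real CARD('n) / 2) = (2 powr 2) powr (real CARD('n) / 2)"
      by simp
    also have "\<dots> = 2 ^ CARD('n)"
      unfolding powr_powr by (simp add: powr_realpow)
    finally show ?thesis
      by (simp add: powr_mult)
  qed
  then show "simplified_series v = solid_angle (gen_cone v)"
    unfolding simplified_series_def solid_angle_gen_cone[OF ind] norm_gen_matrix_chain[OF chain]
      infsetsum_infsum[OF abs, symmetric] infsetsum_chain_term[OF fin, folded eq]
    by simp
qed

section \<open>The associated matrix of a chain\<close>

lemma pos_range: "pos (i :: 'n::finite) \<in> {1..CARD('n)}"
  using bij_betwE[OF bij_betw_pos[where 'n = 'n]] by blast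

text \<open>The entries are compared on equal, neighbouring and distant indices: the choice of signs
  settles the neighbouring ones, and the distant ones vanish on both sides.\<close>

lemma inner_assoc_matrix:
  fixes v :: "nat \<Rightarrow> real^'n"
  assumes "chain_family CARD('n) v"
  shows "x \<bullet> (assoc_matrix v *v x) = (norm (\<Sum>i\<in>UNIV. x $ i *\<^sub>R signed_chain v (pos i)))\<^sup>2"
proof -
  let ?u = "signed_chain v"
  note pos = pos_range[where 'n = 'n]
  have inj: "pos i = pos j \<longleftrightarrow> i = j" for i j :: 'n
    using bij_betw_imp_inj_on[OF bij_betw_pos[where 'n = 'n]] by (rule inj_eq)
  have entry: "assoc_matrix v $ i $ j = ?u (pos i) \<bullet> ?u (pos j)" for i j
  proof -
    consider "i = j" | "pos j = pos i + 1" | "pos i = pos j + 1" | "2 \<le> \<bar>int (pos i) - int (pos j)\<bar>"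
      using inj[of i j] by linarith
    then show ?thesis
    proof cases
      case 1
      then show ?thesis
        using chain_family_signed_chain[OF assms] pos[of j] unfolding chain_family_def
        by (simp add: assoc_matrix_def norm_eq_1)
    next
      case 2
      then show ?thesis
        using signed_chain_inner[of v "pos i", folded 2] by (cases "i = j") (simp_all add: assoc_matrix_def)
    next
      case 3
      then show ?thesis
        using signed_chain_inner[of v "pos j", folded 3]
        by (cases "i = j") (simp_all add: assoc_matrix_def inner_commute)
    next
      case 4
      then have "v (pos i) \<bullet> v (pos j) = 0"
        using assms pos unfolding chain_family_def by blast
      then show ?thesis
        using 4 by (auto simp: assoc_matrix_def signed_chain_def)
    qed
  qed
  have "x \<bullet> (assoc_matrix v *v x) = (\<Sum>i\<in>UNIV. x $ i * (assoc_matrix v *v x) $ i)"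
    by (simp only: inner_vec_def inner_real_def)
  also have "\<dots> = (\<Sum>i\<in>UNIV. \<Sum>j\<in>UNIV. x $ i * x $ j * (?u (pos i) \<bullet> ?u (pos j)))"
    by (simp add: matrix_vector_mult_def entry sum_distrib_left mult_ac)
  also have "\<dots> = (norm (\<Sum>i\<in>UNIV. x $ i *\<^sub>R ?u (pos i)))\<^sup>2"
    unfolding power2_norm_eq_inner inner_sum_left inner_sum_right
    by (intro sum.cong refl) (simp add: mult_ac inner_commute)
  finally show ?thesis .
qed

text \<open>The form is the squared norm of the image of \<open>x\<close> under an invertible
  matrix.\<close>

lemma positive_definite_assoc_matrix:
  fixes v :: "nat \<Rightarrow> real^'n"
  assumes "chain_family CARD('n) v" "indep_family {1..CARD('n)} v"
  shows "positive_definite (assoc_matrix v)"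
  unfolding positive_definite_def
proof (intro conjI allI impI)
  show "transpose (assoc_matrix v) = assoc_matrix v"
    by (simp add: transpose_def assoc_matrix_def vec_eq_iff inner_commute)
  fix x :: "real^'n" assume "x \<noteq> 0"
  have "(\<Sum>i\<in>UNIV. x $ i *\<^sub>R signed_chain v (pos i)) = gen_matrix (signed_chain v) *v x"
    unfolding gen_matrix_mult
    using sum.reindex_bij_betw[OF bij_betw_pos[where 'n = 'n], of "\<lambda>i. coord x i *\<^sub>R signed_chain v i"] by simp
  moreover have "gen_matrix (signed_chain v) *v x \<noteq> 0"
  proof
    assume "gen_matrix (signed_chain v) *v x = 0"
    then have "gen_matrix (signed_chain v) *v x = gen_matrix (signed_chain v) *v 0" by simp
    moreover have "inj ((*v) (gen_matrix (signed_chain v)))"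
      using det_gen_matrix_nonzero[OF indep_family_signed_chain[OF assms(2)]]
      by (intro inj_matrix_vector_mult) (simp add: invertible_det_nz)
    ultimately show False
      using \<open>x \<noteq> 0\<close> by (simp only: inj_eq)
  qed
  ultimately show "0 < x \<bullet> (assoc_matrix v *v x)"
    unfolding inner_assoc_matrix[OF assms(1)] by simp
qed

lemma tridiagonal_assoc_matrix:
  fixes v :: "nat \<Rightarrow> real^'n"
  assumes "chain_family CARD('n) v"
  shows "tridiagonal (assoc_matrix v)"
  unfolding tridiagonal_def
proof (intro allI impI)
  fix i j :: 'n
  assume "2 \<le> \<bar>int (pos i) - int (pos j)\<bar>"
  moreover from this have "v (pos i) \<bullet> v (pos j) = 0"
    using assms pos_range unfolding chain_family_def by blast
  ultimately show "assoc_matrix v $ i $ j = 0"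
    by (auto simp: assoc_matrix_def)
qed

lemma special_generatorsI:
  fixes v w :: "nat \<Rightarrow> real^'n"
  assumes "chain_family CARD('n) v" "v CARD('n) = w CARD('n)"
    and "span (v ` {1..<CARD('n)}) = span (w ` {1..<CARD('n)})"
  shows "special_generators w v"
  unfolding special_generators_def
proof (intro conjI exI[of _ "\<lambda>i. chain_sign (\<lambda>i. v i \<bullet> v (i + 1)) (pos i)"] allI)
  show "chain_sign (\<lambda>i. v i \<bullet> v (i + 1)) (pos i) \<in> {-1, 1}" for i :: 'n
    by (rule chain_sign_values)
  show "x \<bullet> (assoc_matrix v *v x) =
    (norm (\<Sum>i\<in>UNIV. (chain_sign (\<lambda>i. v i \<bullet> v (i + 1)) (pos i) * x $ i) *\<^sub>R v (pos i)))\<^sup>2" for x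
    unfolding inner_assoc_matrix[OF assms(1)] by (simp add: signed_chain_def mult.commute)
qed (use assms in \<open>simp_all add: chain_family_def\<close>)

subsection \<open>Identities modulo lower-dimensional cones\<close>

text \<open>The bound \<open>d\<close> is a parameter: \<open>n + 1\<close> admits all cones in
  dimension \<open>n\<close>, while \<open>n\<close> admits only the lower-dimensional ones. The aim
  is to pass from the former to the latter.\<close>

definition cone_comb :: "int \<Rightarrow> ('a::euclidean_space \<Rightarrow> real) \<Rightarrow> bool" where
  "cone_comb d f \<longleftrightarrow>
     (\<exists>F a. finite F \<and> (\<forall>K\<in>F. polyhedron K \<and> convex_cone K \<and> aff_dim K < d) \<and>
        (\<forall>x. f x = (\<Sum>K\<in>F. a K * indicat_real K x)))"

lemma cone_comb_zero: "cone_comb d (\<lambda>_. 0)"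
  unfolding cone_comb_def by (intro exI[of _ "{}"]) simp

lemma cone_comb_indicator:
  assumes "polyhedron K" "convex_cone K" "aff_dim K < d"
  shows "cone_comb d (\<lambda>x. c * indicat_real K x)"
  unfolding cone_comb_def
proof (intro exI[of _ "{K}"] exI[of _ "\<lambda>_. c"] conjI allI)
  show "c * indicat_real K x = (\<Sum>K\<in>{K}. c * indicat_real K x)" for x
    by (subst sum.insert) auto
qed (use assms in auto)

lemma cone_comb_add:
  assumes "cone_comb d f" "cone_comb d g"
  shows "cone_comb d (\<lambda>x. f x + g x)"
proof -
  obtain F a where F: "finite F" "\<forall>K\<in>F. polyhedron K \<and> convex_cone K \<and> aff_dim K < d"
    "\<forall>x. f x = (\<Sum>K\<in>F. a K * indicat_real K x)"
    using assms(1) unfolding cone_comb_def by blast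
  obtain G b where G: "finite G" "\<forall>K\<in>G. polyhedron K \<and> convex_cone K \<and> aff_dim K < d"
    "\<forall>x. g x = (\<Sum>K\<in>G. b K * indicat_real K x)"
    using assms(2) unfolding cone_comb_def by blast
  \<comment> \<open>Extended by zero, the coefficients can be added even for cones that occur in
    both sums.\<close>
  define a' where "a' = (\<lambda>K. if K \<in> F then a K else 0)"
  define b' where "b' = (\<lambda>K. if K \<in> G then b K else 0)"
  have "f x + g x = (\<Sum>K\<in>F \<union> G. (a' K + b' K) * indicat_real K x)" for x
  proof -
    have "(\<Sum>K\<in>F \<union> G. a' K * indicat_real K x) = (\<Sum>K\<in>F. a' K * indicat_real K x)"
      using F(1) G(1) by (intro sum.mono_neutral_right) (auto simp: a'_def)
    also have "\<dots> = f x"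
      by (simp add: F(3) a'_def)
    finally have f: "(\<Sum>K\<in>F \<union> G. a' K * indicat_real K x) = f x" .
    have "(\<Sum>K\<in>F \<union> G. b' K * indicat_real K x) = (\<Sum>K\<in>G. b' K * indicat_real K x)"
      using F(1) G(1) by (intro sum.mono_neutral_right) (auto simp: b'_def)
    also have "\<dots> = g x"
      by (simp add: G(3) b'_def)
    finally show ?thesis
      using f by (simp add: distrib_right sum.distrib)
  qed
  moreover have "finite (F \<union> G)" "\<forall>K\<in>F \<union> G. polyhedron K \<and> convex_cone K \<and> aff_dim K < d"
    using F(1,2) G(1,2) by auto
  ultimately show ?thesis
    unfolding cone_comb_def by (intro exI[of _ "F \<union> G"] exI[of _ "\<lambda>K. a' K + b' K"]) simp
qed

lemma cone_comb_sum:
  assumes "finite A" "\<And>i. i \<in> A \<Longrightarrow> cone_comb d (f i)"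
  shows "cone_comb d (\<lambda>x. \<Sum>i\<in>A. f i x)"
  using assms by (induction A) (auto intro: cone_comb_zero cone_comb_add)

lemma cone_comb_cmult:
  assumes "cone_comb d f"
  shows "cone_comb d (\<lambda>x. c * f x)"
proof -
  obtain F a where F: "finite F" "\<forall>K\<in>F. polyhedron K \<and> convex_cone K \<and> aff_dim K < d"
    "\<forall>x. f x = (\<Sum>K\<in>F. a K * indicat_real K x)"
    using assms unfolding cone_comb_def by blast
  have "c * f x = (\<Sum>K\<in>F. c * a K * indicat_real K x)" for x
    using F(3) by (simp add: sum_distrib_left mult.assoc)
  then show ?thesis
    unfolding cone_comb_def using F(1,2) by (intro exI[of _ F] exI[of _ "\<lambda>K. c * a K"]) simp
qed

text \<open>Each cone is intersected with \<open>S\<close>. The bound on the dimension comes either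
  from \<open>S\<close> or, when \<open>d = d'\<close>, from the cone itself.\<close>

lemma cone_comb_mult_subspace:
  assumes "cone_comb d f" "subspace S" "int (dim S) < d' \<or> d = d'"
  shows "cone_comb d' (\<lambda>x. f x * indicat_real S x)"
proof -
  obtain F a where F: "finite F" "\<forall>K\<in>F. polyhedron K \<and> convex_cone K \<and> aff_dim K < d"
    "\<forall>x. f x = (\<Sum>K\<in>F. a K * indicat_real K x)"
    using assms(1) unfolding cone_comb_def by blast
  have "cone_comb d' (\<lambda>x. a K * indicat_real (K \<inter> S) x)" if "K \<in> F" for K
  proof (rule cone_comb_indicator)
    show "polyhedron (K \<inter> S)"
      using F(2) that
      by (intro polyhedron_Int[OF _ affine_imp_polyhedron[OF subspace_imp_affine[OF assms(2)]]]) blast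
    show "convex_cone (K \<inter> S)"
      using F(2) that assms(2) unfolding convex_cone_iff subspace_def by blast
    have "aff_dim (K \<inter> S) \<le> aff_dim K" "aff_dim (K \<inter> S) \<le> aff_dim S"
      by (auto intro: aff_dim_subset)
    then show "aff_dim (K \<inter> S) < d'"
      using F(2) that assms(3) aff_dim_subspace[OF assms(2)] by force
  qed
  then have "cone_comb d' (\<lambda>x. \<Sum>K\<in>F. a K * indicat_real (K \<inter> S) x)"
    using F(1) by (rule cone_comb_sum[rotated])
  moreover have "(\<lambda>x. \<Sum>K\<in>F. a K * indicat_real (K \<inter> S) x) = (\<lambda>x. f x * indicat_real S x)"
    using F(3) by (simp add: fun_eq_iff sum_distrib_right indicator_inter_arith mult.assoc)
  ultimately show ?thesis by simp
qed

text \<open>One subspace is removed at a time: \<open>f\<close> splits into its restriction to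
  \<open>S\<close>, a combination of cones of dimension below \<open>d'\<close>, and a rest that
  vanishes off the remaining subspaces.\<close>

lemma cone_comb_vanishing:
  assumes "finite \<S>" "\<And>S. S \<in> \<S> \<Longrightarrow> subspace S \<and> int (dim S) < d'"
    and "cone_comb d f" "\<And>x. x \<notin> \<Union>\<S> \<Longrightarrow> f x = 0"
  shows "cone_comb d' f"
  using assms
proof (induction \<S> arbitrary: f)
  case empty
  then have "f = (\<lambda>_. 0)" by auto
  then show ?case
    by (simp add: cone_comb_zero)
next
  case (insert S \<S>)
  have S: "subspace S" "int (dim S) < d'"
    using insert.prems(1) by auto
  \<comment> \<open>This is \<open>f\<close> times the indicator of the complement of
    \<open>S\<close>; multiplying by the indicator of \<open>S\<close> keeps the bound
    \<open>d\<close>, so the induction hypothesis applies.\<close>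
  define g where "g = (\<lambda>x. f x + (-1) * (f x * indicat_real S x))"
  have "cone_comb d' (\<lambda>x. f x * indicat_real S x)"
    using insert.prems(2) S by (intro cone_comb_mult_subspace) auto
  moreover have "cone_comb d' g"
  proof (rule insert.IH)
    show "cone_comb d g"
      unfolding g_def using insert.prems(2) S(1)
      by (intro cone_comb_add cone_comb_cmult cone_comb_mult_subspace) auto
    show "g x = 0" if "x \<notin> \<Union>\<S>" for x
      using that insert.prems(3)[of x] by (cases "x \<in> S") (auto simp: g_def)
  qed (use insert.prems(1) in auto)
  ultimately have "cone_comb d' (\<lambda>x. f x * indicat_real S x + g x)"
    by (rule cone_comb_add)
  then show ?case
    by (simp add: g_def)
qed

lemma equiv_mod_lower_dim_generic:
  fixes f g :: "real^'n \<Rightarrow> real"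
  assumes "finite \<S>" "\<And>S. S \<in> \<S> \<Longrightarrow> subspace S \<and> dim S < CARD('n)"
    and "cone_comb d f" "cone_comb d g" "\<And>x. x \<notin> \<Union>\<S> \<Longrightarrow> f x = g x"
  shows "equiv_mod_lower_dim f g"
proof -
  have "cone_comb (int CARD('n)) (\<lambda>x. f x + (-1) * g x)"
  proof (rule cone_comb_vanishing[OF assms(1)])
    show "cone_comb d (\<lambda>x. f x + (-1) * g x)"
      by (rule cone_comb_add[OF assms(3) cone_comb_cmult[OF assms(4)]])
  qed (use assms(2,5) in auto)
  then show ?thesis
    by (simp add: cone_comb_def equiv_mod_lower_dim_def)
qed

lemma cone_comb_gen_cone:
  fixes v :: "nat \<Rightarrow> real^'n"
  shows "cone_comb (int CARD('n) + 1) (\<lambda>x. c * indicat_real (gen_cone v) x)"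
  using aff_dim_le_DIM[of "gen_cone v"]
  by (intro cone_comb_indicator polyhedron_gen_cone convex_cone_gen_cone) simp

text \<open>Proper subspaces are null sets, so the indicator identity holds almost everywhere and
  can be integrated against the Gaussian.\<close>

lemma solid_angle_sum_generic:
  fixes C :: "(real^'n) set" and D :: "'i \<Rightarrow> (real^'n) set"
  assumes "finite \<S>" "\<And>S. S \<in> \<S> \<Longrightarrow> subspace S \<and> dim S < CARD('n)"
    and C: "conic C" "C \<in> sets borel"
    and D: "finite M" "\<And>m. m \<in> M \<Longrightarrow> conic (D m)" "\<And>m. m \<in> M \<Longrightarrow> D m \<in> sets borel"
    and eq: "\<And>x. x \<notin> \<Union>\<S> \<Longrightarrow> indicat_real C x = (\<Sum>m\<in>M. s m * indicat_real (D m) x)"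
  shows "solid_angle C = (\<Sum>m\<in>M. s m * solid_angle (D m))"
proof -
  let ?g = "\<lambda>x :: real^'n. exp (- (norm x)\<^sup>2)"
  have "integrable lborel ?g"
    by (rule integrableI_bounded) (simp_all add: nn_integral_gaussian)
  then have int: "integrable lborel (\<lambda>x. indicat_real B x * ?g x)" if "B \<in> sets borel" for B
    using that by (intro integrable_real_mult_indicator[unfolded mult.commute[of _ "indicator _ _"]]) auto
  have "negligible (\<Union>\<S>)"
    using assms(1,2) by (intro negligible_Union) (auto intro: negligible_lowdim)
  moreover have "closed (\<Union>\<S>)"
    using assms(1,2) closed_subspace by (intro closed_Union) auto
  ultimately have "\<Union>\<S> \<in> null_sets lborel"
    by (simp add: negligible_iff_null_sets null_sets_completion_iff)
  then have ae: "AE x in lborel. x \<notin> \<Union>\<S>"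
    by (rule AE_not_in)
  have "(\<integral>x\<in>C. ?g x \<partial>lborel) = (\<integral>x. (\<Sum>m\<in>M. s m * (indicat_real (D m) x * ?g x)) \<partial>lborel)"
    unfolding set_lebesgue_integral_def real_scaleR_def
  proof (rule integral_cong_AE)
    show "AE x in lborel. indicat_real C x * ?g x = (\<Sum>m\<in>M. s m * (indicat_real (D m) x * ?g x))"
      using ae by eventually_elim (simp add: eq sum_distrib_right mult.assoc)
  qed (use C D in auto)
  also have "\<dots> = (\<Sum>m\<in>M. s m * (\<integral>x\<in>D m. ?g x \<partial>lborel))"
    unfolding set_lebesgue_integral_def real_scaleR_def using int D
    by (subst Bochner_Integration.integral_sum) auto
  finally show ?thesis
    using C D by (simp add: solid_angle_gaussian sum_divide_distrib)
qed

section \<open>Assembly of the decomposition\<close>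

lemma gen_cone_eq_cone_on: "gen_cone (v :: nat \<Rightarrow> real^'n) = cone_on {1..CARD('n)} v"
  by (simp add: gen_cone_def cone_on_def)

lemma indep_family_if_independent:
  assumes "finite I" "inj_on w I" "independent (w ` I)"
  shows "indep_family I w"
  unfolding indep_family_def
proof (intro allI impI ballI)
  fix c i assume c: "(\<Sum>i\<in>I. c i *\<^sub>R w i) = 0" and i: "i \<in> I"
  let ?u = "\<lambda>x. c (the_inv_into I w x)"
  have "(\<Sum>x\<in>w ` I. ?u x *\<^sub>R x) = (\<Sum>i\<in>I. c i *\<^sub>R w i)"
    using assms(2) by (simp add: sum.reindex the_inv_into_f_f)
  then have "?u (w i) = 0"
    using c i assms(1) by (intro independentD[OF assms(3), of "w ` I"]) auto
  then show "c i = 0"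
    using assms(2) i by (simp add: the_inv_into_f_f)
qed

theorem corollary4p3:
  fixes w :: "nat \<Rightarrow> real^'n"
  assumes "\<forall>i\<in>{1..CARD('n)}. norm (w i) = 1"
    and "inj_on w {1..CARD('n)}"
    and "independent (w ` {1..CARD('n)})"
  shows "\<exists>(N::nat) (C :: nat \<Rightarrow> (real^'n) set) (s :: nat \<Rightarrow> real) (v :: nat \<Rightarrow> nat \<Rightarrow> real^'n).
     N \<le> fact (CARD('n) - 1) \<and>
     (\<forall>m\<in>{1..N}.
        s m \<in> {-1, 1} \<and>
        C m = gen_cone (v m) \<and>
        aff_dim (C m) = int CARD('n) \<and>
        special_generators w (v m)) \<and>
     equiv_mod_lower_dim (indicat_real (gen_cone w))
       (\<lambda>x. \<Sum>m=1..N. s m * indicat_real (C m) x) \<and>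
     solid_angle (gen_cone w) = (\<Sum>m=1..N. s m * solid_angle (C m)) \<and>
     (\<forall>m\<in>{1..N}.
        positive_definite (assoc_matrix (v m)) \<and>
        tridiagonal (assoc_matrix (v m)) \<and>
        ((\<lambda>b. \<bar>simplified_term (v m) b\<bar>) summable_on multi_exponents CARD('n)) \<and>
        simplified_series (v m) = solid_angle (C m))"
proof -
  let ?n = "CARD('n)"
  let ?I = "{1..?n}"
  have n: "?n \<in> ?I"
    by (simp add: Suc_leI)
  have ind: "indep_family ?I w"
    using assms(2,3) by (intro indep_family_if_independent) auto
  obtain xs \<S> where len: "length xs \<le> fact (?n - 1)"
    and \<S>: "finite \<S>" "\<forall>S\<in>\<S>. subspace S \<and> dim S < ?n"
    and xs: "\<forall>(s, v)\<in>set xs. s \<in> {-1, 1} \<and> is_chain_of ?I ?n w v"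
    and eq: "\<forall>x\<in>span (w ` ?I) - \<Union>\<S>. indicat_real (cone_on ?I w) x =
      (\<Sum>(s, v)\<leftarrow>xs. s * indicat_real (cone_on ?I v) x)"
    using chain_decomposition[OF finite_atLeastAtMost n ind] unfolding card_atLeastAtMost diff_Suc_1
    by (elim exE conjE) (rule that)
  define N where "N = length xs"
  \<comment> \<open>List positions start at \<open>0\<close>, the numbering of the cones at
    \<open>1\<close>.\<close>
  define s where "s = (\<lambda>m. fst (xs ! (m - 1)))"
  define v where "v = (\<lambda>m. snd (xs ! (m - 1)))"
  have sv: "s m \<in> {-1, 1} \<and> is_chain_of ?I ?n w (v m)" if "m \<in> {1..N}" for m
  proof -
    have "(s m, v m) \<in> set xs"
      using that by (auto simp: s_def v_def N_def)
    then show ?thesis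
      using xs by blast
  qed
  \<comment> \<open>The top of each chain is the normalized last generator of the given cone, which
    is that generator itself because it has norm one; this is property (b).\<close>
  have chain: "chain_family ?n (v m)" "indep_family ?I (v m)"
    "v m ?n = w ?n" "span (v m ` {1..<?n}) = span (w ` {1..<?n})" if "m \<in> {1..N}" for m
  proof -
    have "?I - {?n} = {1..<?n}"
      by auto
    then show "chain_family ?n (v m)" "indep_family ?I (v m)"
      "v m ?n = w ?n" "span (v m ` {1..<?n}) = span (w ` {1..<?n})"
      using sv[OF that] assms(1) n by (auto simp: is_chain_of_def)
  qed
  have sum: "(\<Sum>(s, v)\<leftarrow>xs. s * f v) = (\<Sum>m=1..N. s m * f (v m))" for f :: "(nat \<Rightarrow> real^'n) \<Rightarrow> real"
  proof -
    have "(\<Sum>(s, v)\<leftarrow>xs. s * f v) = (\<Sum>i<N. s (Suc i) * f (v (Suc i)))"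
      by (simp add: sum_list_sum_nth atLeast0LessThan N_def s_def v_def case_prod_unfold)
    also have "\<dots> = (\<Sum>m=1..N. s m * f (v m))"
      by (rule sum.reindex_bij_witness[of _ "\<lambda>m. m - 1" Suc]) auto
    finally show ?thesis .
  qed
  \<comment> \<open>The generators span the whole space, so the members of \<open>\<S>\<close>
    contain all exceptional points.\<close>
  have "dim (span (w ` ?I)) = ?n"
    using assms(2,3) by (simp add: dim_eq_card_independent card_image)
  then have "span (w ` ?I) = UNIV"
    using dim_eq_full[of "w ` ?I"] by simp
  then have generic: "indicat_real (gen_cone w) x = (\<Sum>m=1..N. s m * indicat_real (gen_cone (v m)) x)"
    if "x \<notin> \<Union>\<S>" for x
    using eq that unfolding sum gen_cone_eq_cone_on by blast
  show ?thesis
  proof (intro exI conjI ballI)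
    show "N \<le> fact (?n - 1)"
      using len by (simp add: N_def)
    show "equiv_mod_lower_dim (indicat_real (gen_cone w)) (\<lambda>x. \<Sum>m=1..N. s m * indicat_real (gen_cone (v m)) x)"
    proof (rule equiv_mod_lower_dim_generic[OF \<S>(1)])
      \<comment> \<open>The bound \<open>int ?n + 1\<close> admits the full-dimensional cones on
        both sides.\<close>
      show "cone_comb (int ?n + 1) (indicat_real (gen_cone w))"
        using cone_comb_gen_cone[of 1 w] by simp
      show "cone_comb (int ?n + 1) (\<lambda>x. \<Sum>m=1..N. s m * indicat_real (gen_cone (v m)) x)"
        by (intro cone_comb_sum cone_comb_gen_cone) simp
    qed (use \<S>(2) generic in blast)+
    show "solid_angle (gen_cone w) = (\<Sum>m=1..N. s m * solid_angle (gen_cone (v m)))"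
      using \<S> generic convex_cone_gen_cone
      by (intro solid_angle_sum_generic[of \<S>]) (auto simp: convex_cone_def)
    fix m assume m: "m \<in> {1..N}"
    show "s m \<in> {-1, 1}"
      using sv[OF m] by blast
    show "aff_dim (gen_cone (v m)) = int ?n"
      by (intro aff_dim_gen_cone chain(2)[OF m])
    show "special_generators w (v m)"
      by (intro special_generatorsI chain[OF m])
    show "positive_definite (assoc_matrix (v m))"
      by (intro positive_definite_assoc_matrix chain[OF m])
    show "tridiagonal (assoc_matrix (v m))"
      by (intro tridiagonal_assoc_matrix chain[OF m])
    show "(\<lambda>b. \<bar>simplified_term (v m) b\<bar>) summable_on multi_exponents ?n"
      by (intro summable_simplified_term chain[OF m])
    show "simplified_series (v m) = solid_angle (gen_cone (v m))"
      by (intro simplified_series_eq_solid_angle chain[OF m])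
  qed simp
qed

end
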